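(* There exists a subgroup $G_H$ of the additive group $\mathbb{R}$ which is not $\sigma$-compact, has cardinality $\mathfrak{b}$, and is such that for every $k\ge 1$ the finite power $(G_H)^k$ satisfies $\mathsf{U}_{fin}(\mathcal{O},\Gamma)$ (in particular, all finite powers of $G_H$ satisfy $\mathsf{S}_{fin}(\Omega,\Omega)$).
   Context: $\mathfrak{b}$ is the minimal cardinality of a subset of ${}^{\mathbb{N}}\mathbb{N}$ that is unbounded with respect to $\le^*$, where $f\le^* g$ means $f(n)\le g(n)$ for all but finitely many $n$. Subsets of $\mathbb{R}$ and of $\mathbb{R}^k$ carry the subspace topology. For a topological space $X$: an open cover $\mathcal{U}$ of $X$ is an $\omega$-cover if $X\notin\mathcal{U}$ and for each finite $F\subseteq X$ there is $U\in\mathcal{U}$ with $F\subseteq U$; it is a $\gamma$-cover if it is infinite and each $x\in X$ belongs to all but finitely many $U\in\mathcal{U}$. $\mathcal{O},\Omega,\Gamma$ denote the collections of all countable open covers, countable open $\omega$-covers, and countable open $\gamma$-covers of $X$, respectively. For collections $\mathscr{A},\mathscr{B}$ of covers of $X$: $\mathsf{S}_{fin}(\mathscr{A},\mathscr{B})$: for each sequence $\{\mathcal{U}_n\}_{n\in\mathbb{N}}$ of members of $\mathscr{A}$ there exist finite (possibly empty) $\mathcal{F}_n\subseteq\mathcal{U}_n$ such that $\bigcup_n\mathcal{F}_n\in\mathscr{B}$. $\mathsf{U}_{fin}(\mathscr{A},\mathscr{B})$: for each sequence $\{\mathcal{U}_n\}_{n\in\mathbb{N}}$ of members of $\mathscr{A}$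 which do not contain a finite subcover, there exist finite (possibly empty) $\mathcal{F}_n\subseteq\mathcal{U}_n$ such that $\{\bigcup\mathcal{F}_n: n\in\mathbb{N}\}\in\mathscr{B}$. *)

theory Defs
  imports "HOL-Analysis.Analysis" "HOL-Algebra.Group"
begin

unbundle cardinal_syntax

section \<open>The bounding number\<close>

definition le_star :: "(nat \<Rightarrow> nat) \<Rightarrow> (nat \<Rightarrow> nat) \<Rightarrow> bool" (infix "\<le>\<^sup>*" 50)
  where "f \<le>\<^sup>* g \<longleftrightarrow> (\<forall>\<^sub>\<infinity>n. f n \<le> g n)"

definition star_unbounded :: "(nat \<Rightarrow> nat) set \<Rightarrow> bool"
  where "star_unbounded B \<longleftrightarrow> \<not> (\<exists>g. \<forall>f\<in>B. f \<le>\<^sup>* g)"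

text \<open>The bounding number is represented by the cardinal order of an unbounded family of least
  cardinality; by \<open>bounding_number_least\<close> below, such a family exists and the cardinal does not
  depend on the choice up to \<open>=o\<close>.\<close>

definition bounding_number :: "(nat \<Rightarrow> nat) rel" ("\<bb>")
  where "\<bb> = |SOME B. star_unbounded B \<and> (\<forall>C. star_unbounded C \<longrightarrow> |B| \<le>o |C| )|"

lemma star_unbounded_UNIV: "star_unbounded UNIV"
proof -
  have "\<not> (\<lambda>n. Suc (g n)) \<le>\<^sup>* g" for g
    by (simp add: le_star_def)
  then show ?thesis
    unfolding star_unbounded_def by blast
qed

lemma bounding_number_least:
  obtains B where "star_unbounded B" and "\<bb> = |B|"
    and "\<And>C. star_unbounded C \<Longrightarrow> \<bb> \<le>o |C|"
proof -
  let ?R = "card_of ` Collect star_unbounded"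
  have "?R \<noteq> {}" and "\<forall>r\<in>?R. Well_order r"
    using star_unbounded_UNIV card_of_Well_order by auto
  then have "\<exists>r\<in>?R. \<forall>s\<in>?R. r \<le>o s"
    by (rule exists_minim_Well_order)
  then have "\<exists>B. star_unbounded B \<and> (\<forall>C. star_unbounded C \<longrightarrow> |B| \<le>o |C| )"
    by auto
  from someI_ex[OF this] show thesis
    by (intro that[of "SOME B. star_unbounded B \<and> (\<forall>C. star_unbounded C \<longrightarrow> |B| \<le>o |C| )"])
       (auto simp: bounding_number_def)
qed

section \<open>Covers and selection principles\<close>

definition open_cover :: "'a topology \<Rightarrow> 'a set set \<Rightarrow> bool"
  where "open_cover X \<U> \<longleftrightarrow> (\<forall>U\<in>\<U>. openin X U) \<and> \<Union>\<U> = topspace X"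

definition omega_cover :: "'a topology \<Rightarrow> 'a set set \<Rightarrow> bool"
  where "omega_cover X \<U> \<longleftrightarrow> open_cover X \<U> \<and> topspace X \<notin> \<U> \<and>
    (\<forall>F. finite F \<and> F \<subseteq> topspace X \<longrightarrow> (\<exists>U\<in>\<U>. F \<subseteq> U))"

definition gamma_cover :: "'a topology \<Rightarrow> 'a set set \<Rightarrow> bool"
  where "gamma_cover X \<U> \<longleftrightarrow> open_cover X \<U> \<and> infinite \<U> \<and>
    (\<forall>x\<in>topspace X. finite {U \<in> \<U>. x \<notin> U})"

definition countable_open_covers :: "'a topology \<Rightarrow> 'a set set set" ("\<O>")
  where "\<O> X = {\<U>. countable \<U> \<and> open_cover X \<U>}"

definition countable_omega_covers :: "'a topology \<Rightarrow> 'a set set set" ("\<Omega>")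
  where "\<Omega> X = {\<U>. countable \<U> \<and> omega_cover X \<U>}"

definition countable_gamma_covers :: "'a topology \<Rightarrow> 'a set set set" ("\<Gamma>")
  where "\<Gamma> X = {\<U>. countable \<U> \<and> gamma_cover X \<U>}"

definition S_fin :: "'a set set set \<Rightarrow> 'a set set set \<Rightarrow> bool"
  where "S_fin \<A> \<B> \<longleftrightarrow>
    (\<forall>\<U> :: nat \<Rightarrow> 'a set set. (\<forall>n. \<U> n \<in> \<A>) \<longrightarrow>
      (\<exists>\<F>. (\<forall>n. finite (\<F> n) \<and> \<F> n \<subseteq> \<U> n) \<and> (\<Union>n. \<F> n) \<in> \<B>))"

text \<open>The space is an explicit argument because the side condition on the given covers (no finite
  subcover) refers to it.\<close>

definition U_fin :: "'a topology \<Rightarrow> 'a set set set \<Rightarrow> 'a set set set \<Rightarrow> bool"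
  where "U_fin X \<A> \<B> \<longleftrightarrow>
    (\<forall>\<U> :: nat \<Rightarrow> 'a set set.
      (\<forall>n. \<U> n \<in> \<A> \<and> \<not> (\<exists>\<V>. finite \<V> \<and> \<V> \<subseteq> \<U> n \<and> \<Union>\<V> = topspace X)) \<longrightarrow>
      (\<exists>\<F>. (\<forall>n. finite (\<F> n) \<and> \<F> n \<subseteq> \<U> n) \<and> range (\<lambda>n. \<Union>(\<F> n)) \<in> \<B>))"

section \<open>Sets of reals and their finite powers\<close>

definition sigma_compact_space :: "'a topology \<Rightarrow> bool"
  where "sigma_compact_space X \<longleftrightarrow>
    (\<exists>\<K>. countable \<K> \<and> (\<forall>K\<in>\<K>. compactin X K) \<and> \<Union>\<K> = topspace X)"

definition real_group :: "real monoid"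
  where "real_group = \<lparr>carrier = UNIV, monoid.mult = (+), one = 0\<rparr>"

text \<open>Points of \<open>\<real>\<^sup>k\<close> are functions on \<open>{..<k}\<close> (extended by \<open>undefined\<close>), so that \<open>k\<close> can be
  quantified over.\<close>

definition power_space :: "real set \<Rightarrow> nat \<Rightarrow> (nat \<Rightarrow> real) topology"
  where "power_space A k = subtopology (powertop_real {..<k}) ({..<k} \<rightarrow>\<^sub>E A)"

lemma topspace_power_space: "topspace (power_space A k) = ({..<k} \<rightarrow>\<^sub>E A)"
  by (auto simp: power_space_def PiE_def)

lemma power_space_eq_product_topology:
  "power_space A k = product_topology (\<lambda>_. top_of_set A) {..<k}"
  by (simp add: power_space_def subtopology_product_topology)

end

theory Submission
  imports Defs
begin

text \<open>Take a \<open>\<bb>\<close>-scale \<open>S\<close>, that is, an unbounded family of increasing functions that is well-ordered by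
  \<open>\<le>\<^sup>*\<close> with proper initial segments of cardinality less than \<open>\<bb>\<close>, and add the finite sets to the
  ranges of its members. A neighbourhood of the finite sets contains every set with a suitable long
  gap, and all sufficiently late members of the scale have such gaps at the same infinitely many
  places. The remaining tuples have a coordinate that is finite or among the fewer than \<open>\<bb>\<close> early
  members; fixing it lowers the exponent, and fewer than \<open>\<bb>\<close> functions have a common bound. Hence, by
  induction on the exponent, all finite powers have the Hurewicz property.

  Mapping a set \<open>A\<close> to the sum of \<open>1/m!\<close> over the codes \<open>m\<close> of its initial segments embeds the Cantor
  space continuously and independently over the integers into \<open>\<real>\<close>. The group generated by the image
  is a countable union of continuous images of finite powers, which gives the Hurewicz property. If
  the group were \<open>\<sigma>\<close>-compact, independence would write \<open>S\<close> as a countable union of closed subsets of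
  the Baire space, but a closed set that is linearly ordered by \<open>\<le>\<^sup>*\<close> is bounded.\<close>

section \<open>Scales\<close>

lemma le_star_refl: "f \<le>\<^sup>* f"
  by (simp add: le_star_def)

lemma le_star_trans: "f \<le>\<^sup>* g \<Longrightarrow> g \<le>\<^sup>* h \<Longrightarrow> f \<le>\<^sup>* h"
  unfolding le_star_def by (auto elim: eventually_elim2)

lemma le_imp_le_star: "(\<And>n. f n \<le> g n) \<Longrightarrow> f \<le>\<^sup>* g"
  by (simp add: le_star_def)

text \<open>Stands in for \<open>|X| <o \<bb>\<close>: it depends on the size of \<open>X\<close>
  only, passes to images and finite unions, and covers countable sets without a proof that \<bb> is
  uncountable.\<close>

definition dominatable :: "'a set \<Rightarrow> bool"
  where "dominatable X \<longleftrightarrow> (\<forall>F :: 'a \<Rightarrow> nat \<Rightarrow> nat. \<exists>g. \<forall>x\<in>X. F x \<le>\<^sup>* g)"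

lemma dominatableE:
  fixes F :: "'a \<Rightarrow> nat \<Rightarrow> nat"
  assumes "dominatable X"
  obtains g where "\<And>x. x \<in> X \<Longrightarrow> F x \<le>\<^sup>* g"
  using assms unfolding dominatable_def by metis

text \<open>Diagonal bound: at \<open>n\<close> it adds up the functions with indices up to
  \<open>n\<close>, so it is above the \<open>i\<close>-th one from \<open>n = i\<close> on.\<close>

lemma dominatable_countable:
  assumes "countable X"
  shows "dominatable X"
  unfolding dominatable_def
proof (intro allI exI ballI)
  fix F :: "'a \<Rightarrow> nat \<Rightarrow> nat" and x
  assume "x \<in> X"
  then obtain i where i: "x = from_nat_into X i"
    using assms by (metis from_nat_into_to_nat_on)
  have "F x n \<le> (\<Sum>i\<le>n. F (from_nat_into X i) n)" if "i \<le> n" for n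
    unfolding i using that by (intro member_le_sum[of i _ "\<lambda>i. F (from_nat_into X i) n"]) auto
  then show "F x \<le>\<^sup>* (\<lambda>n. \<Sum>i\<le>n. F (from_nat_into X i) n)"
    unfolding le_star_def by (auto simp: eventually_sequentially MOST_nat_le)
qed

lemma dominatable_ordLess:
  assumes "|X| <o \<bb>"
  shows "dominatable X"
  unfolding dominatable_def
proof
  fix F :: "'a \<Rightarrow> nat \<Rightarrow> nat"
  have "|F ` X| <o \<bb>"
    using card_of_image assms by (rule ordLeq_ordLess_trans)
  then have "\<not> star_unbounded (F ` X)"
    using bounding_number_least not_ordLess_ordLeq by metis
  then show "\<exists>g. \<forall>x\<in>X. F x \<le>\<^sup>* g"
    by (auto simp: star_unbounded_def)
qed

lemma dominatable_Un:
  assumes "dominatable X" "dominatable Y"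
  shows "dominatable (X \<union> Y)"
  unfolding dominatable_def
proof
  fix F :: "'a \<Rightarrow> nat \<Rightarrow> nat"
  obtain g h where g: "\<And>x. x \<in> X \<Longrightarrow> F x \<le>\<^sup>* g" and h: "\<And>x. x \<in> Y \<Longrightarrow> F x \<le>\<^sup>* h"
    using dominatableE[OF assms(1)] dominatableE[OF assms(2)] by metis
  have "F x \<le>\<^sup>* (\<lambda>n. g n + h n)" if "x \<in> X \<union> Y" for x
    using that g h le_star_trans[OF _ le_imp_le_star, of "F x" g "\<lambda>n. g n + h n"]
      le_star_trans[OF _ le_imp_le_star, of "F x" h "\<lambda>n. g n + h n"] by auto
  then show "\<exists>g. \<forall>x\<in>X \<union> Y. F x \<le>\<^sup>* g"
    by blast
qed

lemma dominatable_image: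
  assumes "dominatable X"
  shows "dominatable (f ` X)"
  unfolding dominatable_def
proof
  fix F :: "'b \<Rightarrow> nat \<Rightarrow> nat"
  show "\<exists>g. \<forall>x\<in>f ` X. F x \<le>\<^sup>* g"
    using dominatableE[OF assms, of "\<lambda>x. F (f x)"] by (metis imageE)
qed

lemma dominatable_subset: "dominatable X \<Longrightarrow> Y \<subseteq> X \<Longrightarrow> dominatable Y"
  unfolding dominatable_def by (meson subsetD)

text \<open>Choose a bound for each piece; these countably many bounds have a common bound.\<close>

lemma bounded_UN:
  assumes "countable I" "\<And>i. i \<in> I \<Longrightarrow> \<not> star_unbounded (E i)"
  shows "\<not> star_unbounded (\<Union>i\<in>I. E i)"
proof -
  obtain F where F: "\<And>i f. i \<in> I \<Longrightarrow> f \<in> E i \<Longrightarrow> f \<le>\<^sup>* F i"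
    using assms(2) unfolding star_unbounded_def by metis
  obtain g where "\<And>i. i \<in> I \<Longrightarrow> F i \<le>\<^sup>* g"
    using dominatableE[OF dominatable_countable[OF assms(1)]] by metis
  then show ?thesis
    using F le_star_trans unfolding star_unbounded_def by blast
qed

lemma star_unbounded_mono: "star_unbounded A \<Longrightarrow> A \<subseteq> B \<Longrightarrow> star_unbounded B"
  unfolding star_unbounded_def by blast

lemma star_unbounded_infinite:
  assumes "star_unbounded A"
  shows "infinite A"
proof
  assume "finite A"
  then obtain g where "\<And>f. f \<in> A \<Longrightarrow> f \<le>\<^sup>* g"
    using dominatableE[OF dominatable_countable, of A "\<lambda>f. f"] countable_finite by metis
  then show False
    using assms unfolding star_unbounded_def by blast
qed

section \<open>Construction of a \<bb>-scale\<close>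

lemma strict_mono_dominating:
  fixes f g :: "nat \<Rightarrow> nat"
  obtains h where "strict_mono h" "f \<le>\<^sup>* h" "g \<le>\<^sup>* h"
proof
  \<comment> \<open>The summands are positive, so the partial sums increase strictly.\<close>
  let ?h = "\<lambda>n. \<Sum>i\<le>n. f i + g i + 1"
  show "strict_mono ?h"
    by (auto simp: strict_mono_Suc_iff)
  have *: "f n + g n + 1 \<le> ?h n" for n
    by (rule member_le_sum) auto
  have "f n \<le> ?h n" "g n \<le> ?h n" for n
    using *[of n] by linarith+
  then show "f \<le>\<^sup>* ?h" "g \<le>\<^sup>* ?h"
    by (auto intro: le_imp_le_star)
qed

text \<open>Of the well-ordering, only comparability and the smallness of the set of members not
  above a given \<open>g\<close> are kept. Increasing members are determined by their ranges, and
  their values control how sparse these ranges are.\<close>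

locale b_scale =
  fixes S :: "(nat \<Rightarrow> nat) set"
  assumes strict_mono: "f \<in> S \<Longrightarrow> strict_mono f"
    and card: "|S| =o \<bb>"
    and unbounded: "star_unbounded S"
    and linear: "f \<in> S \<Longrightarrow> g \<in> S \<Longrightarrow> f \<le>\<^sup>* g \<or> g \<le>\<^sup>* f"
    and dominatable_initial: "g \<in> S \<Longrightarrow> dominatable {f \<in> S. \<not> g \<le>\<^sup>* f}"

text \<open>Recursion along a well-order of type \<bb> on an unbounded family \<open>B\<close>: the
  value at \<beta> is above \<beta>, which keeps the family unbounded, and above the fewer than
  \<bb> earlier values.\<close>

lemma ex_b_scale: "\<exists>S. b_scale S"
proof -
  obtain B where B: "star_unbounded B" "\<bb> = |B|" and least: "\<And>C. star_unbounded C \<Longrightarrow> \<bb> \<le>o |C|"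
    using bounding_number_least by metis
  define R where "R = |B| - Id"
  have wo: "well_order_on B |B|"
    by (rule card_of_well_order_on)
  then have wf: "wf R"
    by (simp add: R_def well_order_on_def)
  have dom: "dominatable {\<gamma>. (\<gamma>, \<beta>) \<in> R}" for \<beta>
  proof (cases "\<beta> \<in> B")
    case True
    then have "|underS |B| \<beta>| <o \<bb>"
      unfolding B(2) by (intro card_of_underS card_of_Card_order) (simp add: Field_card_of)
    moreover have "{\<gamma>. (\<gamma>, \<beta>) \<in> R} = underS |B| \<beta>"
      by (auto simp: R_def underS_def)
    ultimately show ?thesis
      by (simp add: dominatable_ordLess)
  next
    \<comment> \<open>The recursion runs over the whole type, but an index outside \<open>B\<close>
      has no predecessors.\<close>
    case False
    then have "{\<gamma>. (\<gamma>, \<beta>) \<in> R} = {}"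
      using wo unfolding R_def by (auto dest: well_order_on_domain)
    then show ?thesis
      by (simp add: dominatable_countable)
  qed
  have "\<exists>f. \<forall>\<beta>. strict_mono (f \<beta>) \<and> \<beta> \<le>\<^sup>* f \<beta> \<and> (\<forall>\<gamma>. (\<gamma>, \<beta>) \<in> R \<longrightarrow> f \<gamma> \<le>\<^sup>* f \<beta>)"
  proof (rule dependent_wf_choice[OF wf, of "\<lambda>f \<beta> g. strict_mono g \<and> \<beta> \<le>\<^sup>* g \<and> (\<forall>\<gamma>. (\<gamma>, \<beta>) \<in> R \<longrightarrow> f \<gamma> \<le>\<^sup>* g)"])
    fix \<beta> and f :: "(nat \<Rightarrow> nat) \<Rightarrow> nat \<Rightarrow> nat"
    obtain g where g: "\<And>\<gamma>. (\<gamma>, \<beta>) \<in> R \<Longrightarrow> f \<gamma> \<le>\<^sup>* g"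
      using dominatableE[OF dom] by (metis mem_Collect_eq)
    obtain h where "strict_mono h" "\<beta> \<le>\<^sup>* h" "g \<le>\<^sup>* h"
      using strict_mono_dominating by metis
    then show "\<exists>h. strict_mono h \<and> \<beta> \<le>\<^sup>* h \<and> (\<forall>\<gamma>. (\<gamma>, \<beta>) \<in> R \<longrightarrow> f \<gamma> \<le>\<^sup>* h)"
      using g le_star_trans by blast
  qed simp
  then obtain f where f: "\<And>\<beta>. strict_mono (f \<beta>)" "\<And>\<beta>. \<beta> \<le>\<^sup>* f \<beta>"
    "\<And>\<beta> \<gamma>. (\<gamma>, \<beta>) \<in> R \<Longrightarrow> f \<gamma> \<le>\<^sup>* f \<beta>"
    by blast
  have total: "\<beta> = \<gamma> \<or> (\<beta>, \<gamma>) \<in> R \<or> (\<gamma>, \<beta>) \<in> R" if "\<beta> \<in> B" "\<gamma> \<in> B" for \<beta> \<gamma>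
    using that wo unfolding R_def well_order_on_def linear_order_on_def total_on_def by auto
  have unb: "star_unbounded (f ` B)"
    using B(1) f(2) le_star_trans unfolding star_unbounded_def by blast
  show ?thesis
  proof (intro exI b_scale.intro)
    \<comment> \<open>The values need not be distinct; the image still has size at least \<bb>
      because it is unbounded.\<close>
    show "|f ` B| =o \<bb>"
      using card_of_image[of f B] least[OF unb] by (simp add: B(2) ordIso_iff_ordLeq)
    show "star_unbounded (f ` B)"
      by (rule unb)
    show "g \<le>\<^sup>* h \<or> h \<le>\<^sup>* g" if "g \<in> f ` B" "h \<in> f ` B" for g h
      using that total f(3) le_star_refl by blast
    show "dominatable {h \<in> f ` B. \<not> g \<le>\<^sup>* h}" if "g \<in> f ` B" for g
    proof -
      from that obtain \<beta> where "\<beta> \<in> B" "g = f \<beta>" by blast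
      \<comment> \<open>By totality a member that is not above \<open>f \<beta>\<close> can only be
        the value at an earlier index.\<close>
      then have "{h \<in> f ` B. \<not> g \<le>\<^sup>* h} \<subseteq> f ` {\<gamma>. (\<gamma>, \<beta>) \<in> R}"
        using total f(3) le_star_refl by blast
      then show ?thesis
        by (rule dominatable_subset[OF dominatable_image[OF dom]])
    qed
  qed (use f(1) in auto)
qed

section \<open>Finite powers of a scale together with the finite sets\<close>

text \<open>For finite \<open>I\<close>, these are the open sets of the power of the Cantor space
  with exponent \<open>I\<close>. Points are functions on all of \<open>nat\<close> whose
  coordinates outside \<open>I\<close> do not matter, so the exponent can shrink without a change of
  type.\<close>

definition prefix_open :: "nat set \<Rightarrow> (nat \<Rightarrow> nat set) set \<Rightarrow> bool"
  where "prefix_open I V \<longleftrightarrow>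
    (\<forall>x\<in>V. \<exists>l. \<forall>y. (\<forall>i\<in>I. y i \<inter> {..<l} = x i \<inter> {..<l}) \<longrightarrow> y \<in> V)"

lemma prefix_open_fix:
  assumes "prefix_open I V"
  shows "prefix_open (I - {i}) {x. x(i := s) \<in> V}"
  unfolding prefix_open_def
proof
  fix x assume "x \<in> {x. x(i := s) \<in> V}"
  then obtain l where l: "\<And>y. \<forall>j\<in>I. y j \<inter> {..<l} = (x(i := s)) j \<inter> {..<l} \<Longrightarrow> y \<in> V"
    using assms unfolding prefix_open_def by blast
  have "y(i := s) \<in> V" if "\<forall>j\<in>I - {i}. y j \<inter> {..<l} = x j \<inter> {..<l}" for y
    using that by (intro l) auto
  then show "\<exists>l. \<forall>y. (\<forall>j\<in>I - {i}. y j \<inter> {..<l} = x j \<inter> {..<l}) \<longrightarrow> y \<in> {x. x(i := s) \<in> V}"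
    by blast
qed

text \<open>A tuple that omits \<open>{l..<l'}\<close> agrees below \<open>l'\<close> with its
  truncation to \<open>{..<l}\<close>. There are only finitely many truncations, all made of finite
  sets, and each has a neighbourhood inside some \<open>W m\<close>; \<open>l'\<close> and
  \<open>M\<close> come from sums over them, which serve as common upper bounds.\<close>

lemma prefix_open_gap:
  fixes W :: "nat \<Rightarrow> (nat \<Rightarrow> nat set) set"
  assumes "finite I" and W: "\<And>m. prefix_open I (W m)"
    and cover: "\<And>x. \<forall>i\<in>I. finite (x i) \<Longrightarrow> \<exists>m. x \<in> W m"
  shows "\<exists>l'>l. \<exists>M. \<forall>x. (\<forall>i\<in>I. x i \<inter> {l..<l'} = {}) \<longrightarrow> (\<exists>m\<le>M. x \<in> W m)"
proof -
  define Q where "Q = (I \<rightarrow>\<^sub>E Pow {..<l})"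
  have fin: "finite Q"
    using \<open>finite I\<close> by (simp add: Q_def finite_PiE)
  have "\<forall>q\<in>Q. \<exists>m k. \<forall>y. (\<forall>i\<in>I. y i \<inter> {..<k} = q i \<inter> {..<k}) \<longrightarrow> y \<in> W m"
  proof
    fix q assume "q \<in> Q"
    then have "q i \<subseteq> {..<l}" if "i \<in> I" for i
      using that unfolding Q_def by blast
    then have "\<forall>i\<in>I. finite (q i)"
      using finite_subset by blast
    then obtain m where "q \<in> W m"
      using cover[of q] by blast
    then show "\<exists>m k. \<forall>y. (\<forall>i\<in>I. y i \<inter> {..<k} = q i \<inter> {..<k}) \<longrightarrow> y \<in> W m"
      using W[of m] unfolding prefix_open_def by blast
  qed
  from bchoice[OF this] obtain m
    where "\<forall>q\<in>Q. \<exists>k. \<forall>y. (\<forall>i\<in>I. y i \<inter> {..<k} = q i \<inter> {..<k}) \<longrightarrow> y \<in> W (m q)" ..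
  from bchoice[OF this] obtain k
    where mk: "\<And>q y. q \<in> Q \<Longrightarrow> \<forall>i\<in>I. y i \<inter> {..<k q} = q i \<inter> {..<k q} \<Longrightarrow> y \<in> W (m q)"
    by blast
  define l' where "l' = Suc l + sum k Q"
  have "\<exists>m'\<le>sum m Q. x \<in> W m'" if x: "\<forall>i\<in>I. x i \<inter> {l..<l'} = {}" for x
  proof -
    define q where "q = restrict (\<lambda>i. x i \<inter> {..<l}) I"
    have q: "q \<in> Q"
      by (auto simp: q_def Q_def)
    have "k q \<le> l'"
      using member_le_sum[OF q _ fin, of k] by (simp add: l'_def)
    then have "\<forall>i\<in>I. x i \<inter> {..<k q} = q i \<inter> {..<k q}"
      using x by (force simp: q_def)
    then have "x \<in> W (m q)"
      by (rule mk[OF q])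
    moreover have "m q \<le> sum m Q"
      using member_le_sum[OF q _ fin, of m] by simp
    ultimately show ?thesis
      by blast
  qed
  moreover have "l' > l"
    by (simp add: l'_def)
  ultimately show ?thesis
    by blast
qed

text \<open>Pigeonhole: among the first \<open>card I * j + 1\<close> consecutive gaps, one is missed by all \<open>x i\<close>.\<close>

lemma prefix_open_sparse:
  fixes W :: "nat \<Rightarrow> (nat \<Rightarrow> nat set) set"
  assumes "finite I" and W: "\<And>m. prefix_open I (W m)"
    and cover: "\<And>x. \<forall>i\<in>I. finite (x i) \<Longrightarrow> \<exists>m. x \<in> W m"
  shows "\<exists>h M. \<forall>j x. (\<forall>i\<in>I. card (x i \<inter> {..<h j}) \<le> j) \<longrightarrow> (\<exists>m\<le>M j. x \<in> W m)"
proof -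
  obtain \<phi> \<mu> where \<phi>: "\<And>l. \<phi> l > l"
    and \<mu>: "\<And>l x. \<forall>i\<in>I. x i \<inter> {l..<\<phi> l} = {} \<Longrightarrow> \<exists>m\<le>\<mu> l. x \<in> W m"
    using prefix_open_gap[OF assms] by metis
  \<comment> \<open>The points \<open>L t\<close> cut the line into consecutive gaps, each as long
    as the previous lemma asks for.\<close>
  define L where "L t = (\<phi> ^^ t) 0" for t
  have L_Suc: "L (Suc t) = \<phi> (L t)" for t
    by (simp add: L_def)
  have L: "strict_mono L"
    by (simp add: strict_mono_Suc_iff L_Suc \<phi>)
  define N where "N j = card I * j" for j
  define h where "h j = L (Suc (N j))" for j
  define M where "M j = (\<Sum>t\<le>N j. \<mu> (L t))" for j
  have "\<exists>m\<le>M j. x \<in> W m" if x: "\<forall>i\<in>I. card (x i \<inter> {..<h j}) \<le> j" for j x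
  proof -
    have "\<exists>t\<le>N j. \<forall>i\<in>I. x i \<inter> {L t..<L (Suc t)} = {}"
    proof (rule ccontr)
      \<comment> \<open>Otherwise each of the \<open>N j + 1\<close> gaps contains an element of
        some \<open>x i\<close>; these elements are distinct and below \<open>h j\<close>, where the
        \<open>x i\<close> have at most \<open>N j\<close> elements together.\<close>
      assume neg: "\<not> ?thesis"
      have "\<exists>e. (\<exists>i\<in>I. e \<in> x i) \<and> L t \<le> e \<and> e < L (Suc t)" if "t \<le> N j" for t
      proof -
        from neg that obtain i where "i \<in> I" "x i \<inter> {L t..<L (Suc t)} \<noteq> {}"
          by blast
        then show ?thesis
          by auto
      qed
      then obtain e where e: "\<And>t. t \<le> N j \<Longrightarrow> (\<exists>i\<in>I. e t \<in> x i) \<and> L t \<le> e t \<and> e t < L (Suc t)"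
        by metis
      have less: "e t < e t'" if "t < t'" "t' \<le> N j" for t t'
      proof -
        have "e t < L (Suc t)" "L t' \<le> e t'"
          using e that by auto
        moreover have "L (Suc t) \<le> L t'"
          using that L by (simp add: strict_mono_less_eq)
        ultimately show ?thesis by simp
      qed
      have inj: "inj_on e {..N j}"
        using less by (intro linorder_inj_onI) force+
      have "e t < h j" if "t \<le> N j" for t
      proof -
        have "L (Suc t) \<le> h j"
          using L that by (simp add: strict_mono_less_eq h_def)
        then show ?thesis
          using e[OF that] by simp
      qed
      then have "e ` {..N j} \<subseteq> (\<Union>i\<in>I. x i \<inter> {..<h j})"
        using e by fastforce
      then have "card (e ` {..N j}) \<le> card (\<Union>i\<in>I. x i \<inter> {..<h j})"
        using \<open>finite I\<close> by (intro card_mono) auto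
      also have "\<dots> \<le> (\<Sum>i\<in>I. card (x i \<inter> {..<h j}))"
        by (rule card_UN_le[OF \<open>finite I\<close>])
      also have "\<dots> \<le> N j"
        using sum_bounded_above[of I "\<lambda>i. card (x i \<inter> {..<h j})" j] x by (simp add: N_def)
      finally show False
        by (simp add: card_image[OF inj])
    qed
    then obtain t where t: "t \<le> N j" and "\<forall>i\<in>I. x i \<inter> {L t..<\<phi> (L t)} = {}"
      by (auto simp: L_Suc)
    then obtain m where "m \<le> \<mu> (L t)" "x \<in> W m"
      using \<mu> by blast
    moreover have "\<mu> (L t) \<le> M j"
      unfolding M_def using t by (intro member_le_sum[of t _ "\<lambda>t. \<mu> (L t)"]) auto
    ultimately show ?thesis
      using le_trans by blast
  qed
  then show ?thesis by blast
qed

section \<open>Hurewicz property of the finite powers of \<open>points\<close>\<close>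

lemma card_range_strict_mono_below:
  fixes f :: "nat \<Rightarrow> nat"
  assumes "strict_mono f" "h \<le> f j"
  shows "card (range f \<inter> {..<h}) \<le> j"
proof -
  have "range f \<inter> {..<h} \<subseteq> f ` {..<j}"
    using assms by (force simp: strict_mono_less dest: less_le_trans)
  then have "card (range f \<inter> {..<h}) \<le> card (f ` {..<j})"
    by (intro card_mono) auto
  also have "\<dots> \<le> j"
    using card_image_le[of "{..<j}" f] by simp
  finally show ?thesis .
qed

context b_scale
begin

definition points :: "nat set set"
  where "points = range ` S \<union> Collect finite"

text \<open>If \<open>f j\<close> exceeds \<open>h n j\<close>, every scale member above
  \<open>f\<close> at \<open>j\<close> has at most \<open>j\<close> elements below
  \<open>h n j\<close>, so boundedly many sets of the \<open>n\<close>-th cover suffice.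
  Unboundedness supplies one \<open>f\<close> with such a \<open>j\<close> for every
  \<open>n\<close>.\<close>

lemma hurewicz_late_points:
  fixes V :: "nat \<Rightarrow> nat \<Rightarrow> (nat \<Rightarrow> nat set) set"
  assumes "finite I" and V: "\<And>n m. prefix_open I (V n m)"
    and cover: "\<And>x n. \<forall>i\<in>I. x i \<in> points \<Longrightarrow> \<exists>m. x \<in> V n m"
  shows "\<exists>f\<in>S. \<exists>g. \<forall>x. (\<forall>i\<in>I. x i \<in> range ` {f' \<in> S. f \<le>\<^sup>* f'}) \<longrightarrow> (\<forall>\<^sub>\<infinity>n. \<exists>m\<le>g n. x \<in> V n m)"
proof -
  have "\<forall>n. \<exists>h M. \<forall>j x. (\<forall>i\<in>I. card (x i \<inter> {..<h j}) \<le> j) \<longrightarrow> (\<exists>m\<le>M j. x \<in> V n m)"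
  proof
    fix n
    have "\<exists>m. x \<in> V n m" if "\<forall>i\<in>I. finite (x i)" for x
      using that by (intro cover) (simp add: points_def)
    then show "\<exists>h M. \<forall>j x. (\<forall>i\<in>I. card (x i \<inter> {..<h j}) \<le> j) \<longrightarrow> (\<exists>m\<le>M j. x \<in> V n m)"
      by (rule prefix_open_sparse[OF \<open>finite I\<close> V])
  qed
  then obtain h M
    where hM: "\<And>n j x. \<forall>i\<in>I. card (x i \<inter> {..<h n j}) \<le> j \<Longrightarrow> \<exists>m\<le>M n j. x \<in> V n m"
    by metis
  \<comment> \<open>At \<open>j\<close> only the thresholds of the first \<open>j + 1\<close> covers
    count, so that one function serves all covers; this is why \<open>n \<le> j n\<close> is
    required below.\<close>
  define H where "H j = (\<Sum>n\<le>j. h n j)" for j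
  have H: "h n j \<le> H j" if "n \<le> j" for n j
    unfolding H_def using that by (intro member_le_sum[of n _ "\<lambda>n. h n j"]) auto
  obtain f where f: "f \<in> S" "\<not> f \<le>\<^sup>* H"
    using unbounded unfolding star_unbounded_def by blast
  then have "\<exists>j\<ge>n. H j < f j" for n
    unfolding le_star_def MOST_nat_le by (meson not_le)
  then obtain j where j: "\<And>n. n \<le> j n" "\<And>n. H (j n) < f (j n)"
    by metis
  have "\<forall>\<^sub>\<infinity>n. \<exists>m\<le>M n (j n). x \<in> V n m"
    if x: "\<forall>i\<in>I. x i \<in> range ` {f' \<in> S. f \<le>\<^sup>* f'}" for x
  proof -
    have "\<forall>i\<in>I. \<exists>F. F \<in> S \<and> f \<le>\<^sup>* F \<and> x i = range F"
      using x by blast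
    then obtain F where F: "\<And>i. i \<in> I \<Longrightarrow> F i \<in> S \<and> f \<le>\<^sup>* F i \<and> x i = range (F i)"
      by metis
    have "\<forall>i\<in>I. \<exists>k. \<forall>n\<ge>k. f n \<le> F i n"
      using F unfolding le_star_def MOST_nat_le by blast
    then obtain k where k: "\<And>i n. i \<in> I \<Longrightarrow> k i \<le> n \<Longrightarrow> f n \<le> F i n"
      by metis
    have "\<exists>m\<le>M n (j n). x \<in> V n m" if n: "n \<ge> sum k I" for n
    proof (rule hM, rule ballI)
      fix i assume i: "i \<in> I"
      have "k i \<le> sum k I"
        using i \<open>finite I\<close> by (intro member_le_sum) auto
      then have "f (j n) \<le> F i (j n)"
        using k i n j(1)[of n] by simp
      then have "h n (j n) \<le> F i (j n)"
        using H[OF j(1)[of n]] j(2)[of n] by simp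
      then show "card (x i \<inter> {..<h n (j n)}) \<le> j n"
        using F[OF i] strict_mono card_range_strict_mono_below by metis
    qed
    then show ?thesis
      unfolding MOST_nat_le by blast
  qed
  then show ?thesis
    using f(1) by (intro bexI[of _ f] exI[of _ "\<lambda>n. M n (j n)"]) auto
qed

text \<open>Either all coordinates are late, or some coordinate \<open>i\<close> lies in the small
  set \<open>T\<close>. For each fixed value in \<open>T\<close> the induction hypothesis for
  \<open>I - {i}\<close> gives a bound, and these bounds have a common one. The finitely many bounds
  for the different cases are added up.\<close>

proposition hurewicz_points:
  fixes V :: "nat \<Rightarrow> nat \<Rightarrow> (nat \<Rightarrow> nat set) set"
  assumes "finite I" and "\<And>n m. prefix_open I (V n m)"
    and "\<And>x n. \<forall>i\<in>I. x i \<in> points \<Longrightarrow> \<exists>m. x \<in> V n m"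
  shows "\<exists>g. \<forall>x. (\<forall>i\<in>I. x i \<in> points) \<longrightarrow> (\<forall>\<^sub>\<infinity>n. \<exists>m\<le>g n. x \<in> V n m)"
  using assms
proof (induction I arbitrary: V rule: finite_psubset_induct)
  case (psubset I)
  note V = psubset.prems(1) and cover = psubset.prems(2)
  have "\<exists>f\<in>S. \<exists>g. \<forall>x. (\<forall>i\<in>I. x i \<in> range ` {f' \<in> S. f \<le>\<^sup>* f'}) \<longrightarrow> (\<forall>\<^sub>\<infinity>n. \<exists>m\<le>g n. x \<in> V n m)"
    using psubset.hyps V cover by (rule hurewicz_late_points)
  then obtain f g0 where f: "f \<in> S"
    and g0: "\<And>x. \<forall>i\<in>I. x i \<in> range ` {f' \<in> S. f \<le>\<^sup>* f'} \<Longrightarrow> \<forall>\<^sub>\<infinity>n. \<exists>m\<le>g0 n. x \<in> V n m"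
    by blast
  define T where "T = range ` {f' \<in> S. \<not> f \<le>\<^sup>* f'} \<union> Collect finite"
  have T: "dominatable T"
    unfolding T_def
    by (intro dominatable_Un dominatable_image dominatable_initial f dominatable_countable countable_Collect_finite)
  have T_points: "T \<subseteq> points" "points \<subseteq> range ` {f' \<in> S. f \<le>\<^sup>* f'} \<union> T"
    by (auto simp: T_def points_def)
  have "\<exists>g. \<forall>x. (\<forall>j\<in>I. x j \<in> points) \<and> x i \<in> T \<longrightarrow> (\<forall>\<^sub>\<infinity>n. \<exists>m\<le>g n. x \<in> V n m)" if i: "i \<in> I" for i
  proof -
    have "\<exists>g. \<forall>x. (\<forall>j\<in>I - {i}. x j \<in> points) \<longrightarrow> (\<forall>\<^sub>\<infinity>n. \<exists>m\<le>g n. x \<in> {x. x(i := s) \<in> V n m})"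
      if "s \<in> T" for s
    proof (rule psubset.IH)
      show "\<exists>m. x \<in> {x. x(i := s) \<in> V n m}" if "\<forall>j\<in>I - {i}. x j \<in> points" for x n
      proof -
        have "\<forall>j\<in>I. (x(i := s)) j \<in> points"
          using that \<open>s \<in> T\<close> T_points(1) by auto
        then show ?thesis
          unfolding mem_Collect_eq by (rule cover)
      qed
      show "prefix_open (I - {i}) {x. x(i := s) \<in> V n m}" for n m
        by (rule prefix_open_fix[OF V])
      show "I - {i} \<subset> I"
        using i by blast
    qed
    then have "\<forall>s\<in>T. \<exists>g. \<forall>x. (\<forall>j\<in>I - {i}. x j \<in> points) \<longrightarrow>
        (\<forall>\<^sub>\<infinity>n. \<exists>m\<le>g n. x(i := s) \<in> V n m)"
      unfolding mem_Collect_eq by blast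
    from bchoice[OF this] obtain G where G: "\<And>s x. s \<in> T \<Longrightarrow> \<forall>j\<in>I - {i}. x j \<in> points \<Longrightarrow>
        \<forall>\<^sub>\<infinity>n. \<exists>m\<le>G s n. x(i := s) \<in> V n m"
      by blast
    obtain g where g: "\<And>s. s \<in> T \<Longrightarrow> G s \<le>\<^sup>* g"
      using dominatableE[OF T] by metis
    have "\<forall>\<^sub>\<infinity>n. \<exists>m\<le>g n. x \<in> V n m" if "\<forall>j\<in>I. x j \<in> points" "x i \<in> T" for x
    proof -
      have "\<forall>\<^sub>\<infinity>n. \<exists>m\<le>G (x i) n. x \<in> V n m"
        using G[of "x i" x] that by simp
      moreover have "\<forall>\<^sub>\<infinity>n. G (x i) n \<le> g n"
        using g[OF that(2)] by (simp add: le_star_def)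
      ultimately show ?thesis
        by (rule eventually_elim2) (meson le_trans)
    qed
    then show ?thesis by blast
  qed
  then have "\<forall>i\<in>I. \<exists>g. \<forall>x. (\<forall>j\<in>I. x j \<in> points) \<and> x i \<in> T \<longrightarrow>
      (\<forall>\<^sub>\<infinity>n. \<exists>m\<le>g n. x \<in> V n m)"
    by blast
  from bchoice[OF this] obtain g where g: "\<And>i x. i \<in> I \<Longrightarrow> \<forall>j\<in>I. x j \<in> points \<Longrightarrow> x i \<in> T \<Longrightarrow>
      \<forall>\<^sub>\<infinity>n. \<exists>m\<le>g i n. x \<in> V n m"
    by blast
  have "\<forall>\<^sub>\<infinity>n. \<exists>m\<le>g0 n + (\<Sum>i\<in>I. g i n). x \<in> V n m" if x: "\<forall>i\<in>I. x i \<in> points" for x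
  proof (cases "\<exists>i\<in>I. x i \<in> T")
    case True
    then obtain i where i: "i \<in> I" "x i \<in> T"
      by blast
    have le: "g i n \<le> g0 n + (\<Sum>i\<in>I. g i n)" for n
      using member_le_sum[of i I "\<lambda>i. g i n"] i(1) psubset.hyps by simp
    from g[OF i(1) x i(2)] show ?thesis
      by (rule eventually_mono) (use le le_trans in blast)
  next
    case False
    then have "\<forall>i\<in>I. x i \<in> range ` {f' \<in> S. f \<le>\<^sup>* f'}"
      using x T_points(2) by blast
    from g0[OF this] show ?thesis
      by (rule eventually_mono) (meson trans_le_add1)
  qed
  then show ?case
    by (intro exI[of _ "\<lambda>n. g0 n + (\<Sum>i\<in>I. g i n)"]) blast
qed

end

section \<open>An independent family of reals indexed by the subsets of the natural numbers\<close>

text \<open>The code of the initial segment of \<open>A\<close> of length \<open>n\<close>, with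
  \<open>n\<close> added as largest element to record the length.\<close>

definition node :: "nat set \<Rightarrow> nat \<Rightarrow> nat"
  where "node A n = set_encode (insert n (A \<inter> {..<n}))"

definition branch :: "nat set \<Rightarrow> nat set"
  where "branch A = range (node A)"

lemma node_gt: "n < node A n"
proof -
  have "n < 2 ^ n"
    by simp
  also have "\<dots> \<le> node A n"
    by (simp add: node_def)
  finally show ?thesis .
qed

lemma node_eqD:
  assumes "node A n = node B m"
  shows "n = m" "A \<inter> {..<n} = B \<inter> {..<n}"
proof -
  have eq: "insert n (A \<inter> {..<n}) = insert m (B \<inter> {..<m})"
    using assms unfolding node_def by (subst (asm) set_encode_eq) auto
  then have "n \<le> m" "m \<le> n"
    using eq[THEN eqset_imp_iff, of n] eq[THEN eqset_imp_iff, of m] by auto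
  then show nm: "n = m"
    by simp
  show "A \<inter> {..<n} = B \<inter> {..<n}"
    using arg_cong[OF eq, of "\<lambda>X. X \<inter> {..<n}"] nm by simp
qed

lemma infinite_branch: "infinite (branch A)"
  unfolding branch_def using node_eqD(1) by (intro range_inj_infinite injI)

text \<open>At a common node the two sets have the same initial segment, so its length does not
  exceed a point where they differ.\<close>

lemma finite_branch_Int:
  assumes "A \<noteq> B"
  shows "finite (branch A \<inter> branch B)"
proof -
  obtain i where i: "(i \<in> A) \<noteq> (i \<in> B)"
    using assms by blast
  have "branch A \<inter> branch B \<subseteq> node A ` {..i}"
  proof
    fix e assume "e \<in> branch A \<inter> branch B"
    then obtain n m where n: "e = node A n" "e = node B m"
      unfolding branch_def by blast
    then have "A \<inter> {..<n} = B \<inter> {..<n}"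
      using node_eqD(2)[of A n B m] by simp
    then have "n \<le> i"
      using i by (auto simp: set_eq_iff intro: leI)
    with n show "e \<in> node A ` {..i}"
      by simp
  qed
  then show ?thesis
    by (rule finite_subset) simp
qed

text \<open>A code exceeds the length of its initial segment, so codes below \<open>l\<close> come
  from segments shorter than \<open>l\<close>.\<close>

lemma branch_cong_below:
  assumes "A \<inter> {..<l} = B \<inter> {..<l}" "m < l"
  shows "m \<in> branch A \<longleftrightarrow> m \<in> branch B"
proof -
  have "node A n = node B n" if "n < l" for n
  proof -
    have "A \<inter> {..<n} = (A \<inter> {..<l}) \<inter> {..<n}" "B \<inter> {..<n} = (B \<inter> {..<l}) \<inter> {..<n}"
      using that by auto
    then show ?thesis
      by (simp add: node_def assms(1))
  qed
  then have "\<forall>n. n < l \<longrightarrow> (m = node A n \<longleftrightarrow> m = node B n)"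
    by simp
  moreover have "n < l" if "m = node A n \<or> m = node B n" for n
    using that assms(2) node_gt[of n A] node_gt[of n B] by auto
  ultimately show ?thesis
    unfolding branch_def image_iff by blast
qed

section \<open>Series with bounded numerators over the factorials\<close>

text \<open>Each of the \<open>m\<close> additional factors is at least 2. This lets a geometric
  series of ratio 1/2 dominate the tails.\<close>

lemma fact_add_ge: "fact (m + Suc n) \<ge> fact (Suc n) * (2 :: real) ^ m"
proof (induction m)
  case (Suc m)
  have "fact (Suc n) * (2 :: real) ^ Suc m = 2 * (fact (Suc n) * 2 ^ m)"
    by simp
  also have "\<dots> \<le> real (Suc m + Suc n) * fact (m + Suc n)"
    using Suc by (intro mult_mono) auto
  also have "\<dots> = fact (Suc m + Suc n)"
    by (simp add: algebra_simps)
  finally show ?case .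
qed simp

lemma bounded_div_fact_summable:
  fixes d :: "nat \<Rightarrow> real"
  assumes "\<And>m. \<bar>d m\<bar> \<le> D"
  shows "summable (\<lambda>m. d m / fact m)"
proof (rule summable_comparison_test')
  show "summable (\<lambda>m. D * inverse (fact m))"
    using summable_exp[of "1 :: real"] by (intro summable_mult) simp
  show "norm (d m / fact m) \<le> D * inverse (fact m)" if "m \<ge> 0" for m
    using assms[of m] by (simp add: divide_inverse mult_right_mono abs_mult)
qed

lemma bounded_div_fact_tail:
  fixes d :: "nat \<Rightarrow> real"
  assumes "\<And>m. \<bar>d m\<bar> \<le> D"
  shows "\<bar>\<Sum>m. d (m + Suc n) / fact (m + Suc n)\<bar> \<le> 2 * D / fact (Suc n)"
proof -
  let ?c = "\<lambda>m. D / fact (Suc n) * (1 / 2) ^ m"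
  have "D \<ge> 0"
    using assms[of 0] by simp
  have le: "norm (d (m + Suc n) / fact (m + Suc n)) \<le> ?c m" for m
  proof -
    have "norm (d (m + Suc n) / fact (m + Suc n)) \<le> D / fact (m + Suc n)"
      using assms[of "m + Suc n"] by (simp add: divide_right_mono del: fact_Suc)
    also have "\<dots> \<le> D / (fact (Suc n) * 2 ^ m)"
      using fact_add_ge[of n m] \<open>D \<ge> 0\<close> by (intro divide_left_mono) auto
    also have "\<dots> = ?c m"
      by (simp add: power_divide)
    finally show ?thesis .
  qed
  have c: "?c sums (D / fact (Suc n) * 2)"
    using sums_mult[OF geometric_sums[of "1 / 2 :: real"], of "D / fact (Suc n)"] by simp
  have "norm (\<Sum>m. d (m + Suc n) / fact (m + Suc n)) \<le> suminf ?c"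
    by (rule norm_suminf_le[OF le]) (use c sums_summable in blast)
  then show ?thesis
    using sums_unique[OF c] by (simp add: mult.commute del: fact_Suc)
qed

text \<open>Scaled by \<open>n!\<close> the partial sum up to \<open>n\<close> is an integer, while the tail is small.\<close>

lemma bounded_div_fact_sum_zero:
  fixes d :: "nat \<Rightarrow> int"
  assumes D: "\<And>m. \<bar>real_of_int (d m)\<bar> \<le> D" and zero: "(\<Sum>m. real_of_int (d m) / fact m) = 0"
  shows "\<forall>\<^sub>\<infinity>m. d m = 0"
proof -
  let ?f = "\<lambda>m. real_of_int (d m) / fact m"
  \<comment> \<open>Times \<open>fact n\<close> the tail is at most \<open>2 * D / Suc n\<close>,
    whence the condition on \<open>n\<close>.\<close>
  have partial: "sum ?f {..<Suc n} = 0" if n: "2 * D < Suc n" for n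
  proof -
    have "sum ?f {..<Suc n} = - (\<Sum>m. ?f (m + Suc n))"
      using suminf_split_initial_segment[OF bounded_div_fact_summable[where d = "\<lambda>m. real_of_int (d m)", OF D], of "Suc n"] zero by simp
    then have "\<bar>sum ?f {..<Suc n}\<bar> \<le> 2 * D / fact (Suc n)"
      using bounded_div_fact_tail[where d = "\<lambda>m. real_of_int (d m)", OF D, of n] by simp
    then have "\<bar>sum ?f {..<Suc n}\<bar> * fact n \<le> 2 * D / fact (Suc n) * fact n"
      by (rule mult_right_mono) simp
    also have "\<dots> = 2 * D / Suc n"
      by (simp add: divide_simps)
    also have "\<dots> < 1"
      using n by simp
    finally have "\<bar>sum ?f {..<Suc n} * fact n\<bar> < 1"
      by (simp add: abs_mult)
    moreover have "sum ?f {..<Suc n} * fact n \<in> \<int>"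
      unfolding sum_distrib_right
    proof (rule Ints_sum)
      fix m assume "m \<in> {..<Suc n}"
      then have "(fact m :: nat) dvd fact n"
        by (intro fact_dvd) simp
      then have "(fact n :: real) / fact m = of_nat (fact n div fact m)"
        by (simp add: real_of_nat_div)
      then have "?f m * fact n = of_int (d m * int (fact n div fact m))"
        by (simp add: field_simps)
      then show "?f m * fact n \<in> \<int>"
        by (metis Ints_of_int)
    qed
    ultimately have "sum ?f {..<Suc n} * fact n = 0"
      by (metis Ints_nonzero_abs_less1)
    then show ?thesis
      by simp
  qed
  obtain N where N: "2 * D < real N"
    using reals_Archimedean2 by blast
  \<comment> \<open>Two consecutive partial sums vanish, hence so does the term by which they
    differ.\<close>
  have "d n = 0" if n: "n > N" for n
  proof -
    obtain n' where n': "n = Suc n'"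
      using n by (cases n) auto
    have "sum ?f {..<Suc n} = 0" "sum ?f {..<n} = 0"
      unfolding n' using n N n' by (auto intro!: partial simp del: sum.lessThan_Suc)
    then show ?thesis
      by simp
  qed
  then show ?thesis
    unfolding MOST_nat by blast
qed

section \<open>The embedding of the Cantor space and its independence\<close>

definition branch_real :: "nat set \<Rightarrow> real"
  where "branch_real A = (\<Sum>m. indicator (branch A) m / fact m)"

lemma summable_branch_real: "summable (\<lambda>m. indicator (branch A) m / fact m :: real)"
  by (rule bounded_div_fact_summable[of _ 1]) (simp add: indicator_def)

text \<open>The branches agree below \<open>Suc l\<close>, so only a tail with numerators bounded by
  1 remains.\<close>

lemma branch_real_close:
  assumes "A \<inter> {..<Suc l} = B \<inter> {..<Suc l}"
  shows "\<bar>branch_real A - branch_real B\<bar> \<le> 2 / fact (Suc l)"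
proof -
  define d :: "nat \<Rightarrow> real" where "d m = indicator (branch A) m - indicator (branch B) m" for m
  have d: "\<bar>d m\<bar> \<le> 1" for m
    by (simp add: d_def indicator_def)
  have "branch_real A - branch_real B = (\<Sum>m. d m / fact m)"
    unfolding branch_real_def d_def using suminf_diff[OF summable_branch_real summable_branch_real]
    by (simp add: diff_divide_distrib)
  also have "\<dots> = (\<Sum>m. d (m + Suc l) / fact (m + Suc l)) + (\<Sum>m<Suc l. d m / fact m)"
    using bounded_div_fact_summable[where d = d, OF d] by (rule suminf_split_initial_segment)
  also have "(\<Sum>m<Suc l. d m / fact m) = 0"
    by (rule sum.neutral) (use branch_cong_below[OF assms] in \<open>auto simp: d_def indicator_def\<close>)
  finally show ?thesis
    using bounded_div_fact_tail[where d = d, OF d, of l] by simp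
qed

lemma branch_real_uniformly_continuous:
  assumes "e > 0"
  obtains l where "\<And>A B. A \<inter> {..<l} = B \<inter> {..<l} \<Longrightarrow> \<bar>branch_real A - branch_real B\<bar> < e"
proof -
  obtain l where "2 / e < real l"
    using reals_Archimedean2 by blast
  also have "real l \<le> fact (Suc l)"
    using fact_ge_self[of "Suc l"] by (metis Suc_leD of_nat_fact of_nat_le_iff)
  finally have "2 / fact (Suc l) < e"
    using assms by (simp add: field_simps del: fact_Suc)
  then show thesis
    using branch_real_close by (intro that[of "Suc l"]) (meson le_less_trans)
qed

text \<open>The difference of both sides is a series with bounded integer numerators
  \<open>d m\<close>, so almost all of them vanish. If \<open>y\<close> were outside
  \<open>P\<close>, its branch would meet each of the finitely many branches of the right-hand side
  in a finite set; at all but finitely many of its nodes \<open>d m\<close> would then be 1.\<close>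

lemma branch_real_independent:
  fixes r :: "real \<Rightarrow> int"
  assumes "finite t" "t \<subseteq> branch_real ` P" and eq: "branch_real y = (\<Sum>a\<in>t. of_int (r a) * a)"
  shows "y \<in> P"
proof (rule ccontr)
  assume "y \<notin> P"
  have "\<forall>a\<in>t. \<exists>x. x \<in> P \<and> branch_real x = a"
    using assms(2) by blast
  then obtain x where x: "\<And>a. a \<in> t \<Longrightarrow> x a \<in> P \<and> branch_real (x a) = a"
    by metis
  define d :: "nat \<Rightarrow> int"
    where "d m = indicator (branch y) m - (\<Sum>a\<in>t. r a * indicator (branch (x a)) m)" for m
  have bound: "\<bar>real_of_int (d m)\<bar> \<le> 1 + (\<Sum>a\<in>t. \<bar>real_of_int (r a)\<bar>)" for m
  proof -
    have "\<bar>\<Sum>a\<in>t. r a * indicator (branch (x a)) m\<bar> \<le> (\<Sum>a\<in>t. \<bar>r a\<bar>)"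
      by (rule order_trans[OF sum_abs]) (auto intro!: sum_mono simp: indicator_def)
    moreover have "\<bar>indicator (branch y) m :: int\<bar> \<le> 1"
      by (simp add: indicator_def)
    ultimately have "\<bar>d m\<bar> \<le> 1 + (\<Sum>a\<in>t. \<bar>r a\<bar>)"
      unfolding d_def by linarith
    then have "real_of_int \<bar>d m\<bar> \<le> real_of_int (1 + (\<Sum>a\<in>t. \<bar>r a\<bar>))"
      by (simp only: of_int_le_iff)
    then show ?thesis
      by simp
  qed
  have "(\<lambda>m. indicator (branch y) m / fact m - (\<Sum>a\<in>t. of_int (r a) * (indicator (branch (x a)) m / fact m)))
      sums (branch_real y - (\<Sum>a\<in>t. of_int (r a) * branch_real (x a)))"
    unfolding branch_real_def
    by (intro sums_diff sums_sum sums_mult summable_sums summable_branch_real)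
  moreover have "(\<lambda>m. indicator (branch y) m / fact m - (\<Sum>a\<in>t. of_int (r a) * (indicator (branch (x a)) m / fact m)))
      = (\<lambda>m. real_of_int (d m) / fact m)"
    by (auto simp: d_def fun_eq_iff diff_divide_distrib sum_divide_distrib indicator_def intro!: sum.cong)
  moreover have "branch_real y - (\<Sum>a\<in>t. of_int (r a) * branch_real (x a)) = 0"
    using eq x by simp
  ultimately have "(\<Sum>m. real_of_int (d m) / fact m) = 0"
    using sums_unique by fastforce
  from bounded_div_fact_sum_zero[OF bound this] have fin: "finite {m. d m \<noteq> 0}"
    by (simp add: eventually_cofinite)
  have "finite (branch y \<inter> branch (x a))" if "a \<in> t" for a
    using x[OF that] \<open>y \<notin> P\<close> by (intro finite_branch_Int) auto
  then have "finite ({m. d m \<noteq> 0} \<union> (\<Union>a\<in>t. branch y \<inter> branch (x a)))"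
    using fin \<open>finite t\<close> by blast
  then obtain m where m: "m \<in> branch y" "m \<notin> {m. d m \<noteq> 0} \<union> (\<Union>a\<in>t. branch y \<inter> branch (x a))"
    using infinite_branch[of y] by (meson finite_subset subsetI)
  then have "(\<Sum>a\<in>t. r a * indicator (branch (x a)) m) = 0"
    by (intro sum.neutral) auto
  then have "d m = 1"
    using m(1) by (simp add: d_def)
  with m(2) show False
    by simp
qed

lemma inj_branch_real: "inj branch_real"
proof (rule injI)
  fix x y assume "branch_real x = branch_real y"
  then have "x \<in> {y}"
    by (intro branch_real_independent[of "{branch_real y}" "{y}" x "\<lambda>_. 1"]) auto
  then show "x = y"
    by simp
qed

text \<open>The reals as a module over the integers: the span of a set is the subgroup that it
  generates.\<close>

interpretation int_span: module "\<lambda>(k :: int) (x :: real). of_int k * x"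
  by unfold_locales (auto simp: algebra_simps)

lemma branch_real_in_int_span: "branch_real y \<in> int_span.span (branch_real ` P) \<Longrightarrow> y \<in> P"
  unfolding int_span.span_explicit using branch_real_independent by blast

section \<open>Finite powers of the generated group\<close>

text \<open>For each coefficient matrix \<open>M\<close> a continuous map from tuples of sets to
  \<open>k\<close>-tuples of reals. Matrices are lists so that they form a countable type.\<close>

definition lin_comb :: "nat \<Rightarrow> nat \<Rightarrow> int list list \<Rightarrow> (nat \<Rightarrow> nat set) \<Rightarrow> nat \<Rightarrow> real"
  where "lin_comb k N M x = (\<lambda>j\<in>{..<k}. \<Sum>i<N. of_int (M ! j ! i) * branch_real (x i))"

text \<open>Continuity, from the uniform continuity of \<open>branch_real\<close> in each of the
  finitely many entries.\<close>

lemma prefix_open_lin_comb: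
  assumes "openin (powertop_real {..<k}) U"
  shows "prefix_open {..<N} {x. lin_comb k N M x \<in> U}"
  unfolding prefix_open_def
proof
  fix x assume "x \<in> {x. lin_comb k N M x \<in> U}"
  then have "lin_comb k N M x \<in> U"
    by simp
  with assms[unfolded openin_product_topology_alt] obtain B
    where "\<forall>j\<in>{..<k}. openin euclidean (B j)"
      and B: "lin_comb k N M x \<in> PiE {..<k} B" "PiE {..<k} B \<subseteq> U"
    by (elim ballE[of _ _ "lin_comb k N M x"] exE conjE) blast+
  then have open_B: "open (B j)" if "j < k" for j
    using that by simp
  have "\<exists>l. \<forall>y. (\<forall>i\<in>{..<N}. y i \<inter> {..<l} = x i \<inter> {..<l}) \<longrightarrow> lin_comb k N M y j \<in> B j" if j: "j < k" for j
  proof -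
    have "lin_comb k N M x j \<in> B j"
      using B(1) j by auto
    then obtain e where e: "e > 0" "ball (lin_comb k N M x j) e \<subseteq> B j"
      using open_B[OF j] open_contains_ball by blast
    \<comment> \<open>The \<open>+ 1\<close> avoids division by zero for a zero row and makes the
      final estimate \<open>(c - 1) * (e / c) < e\<close> strict.\<close>
    define c where "c = (\<Sum>i<N. \<bar>real_of_int (M ! j ! i)\<bar>) + 1"
    have c: "c > 0"
      unfolding c_def by (intro add_nonneg_pos sum_nonneg) auto
    obtain l where l: "\<And>A B. A \<inter> {..<l} = B \<inter> {..<l} \<Longrightarrow> \<bar>branch_real A - branch_real B\<bar> < e / c"
      using branch_real_uniformly_continuous[of "e / c"] e(1) c by auto
    have "lin_comb k N M y j \<in> B j" if y: "\<forall>i\<in>{..<N}. y i \<inter> {..<l} = x i \<inter> {..<l}" for y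
    proof -
      have "\<bar>lin_comb k N M y j - lin_comb k N M x j\<bar>
          = \<bar>\<Sum>i<N. of_int (M ! j ! i) * (branch_real (y i) - branch_real (x i))\<bar>"
        using \<open>j < k\<close> by (simp add: lin_comb_def sum_subtractf right_diff_distrib)
      also have "\<dots> \<le> (\<Sum>i<N. \<bar>of_int (M ! j ! i)\<bar> * (e / c))"
      proof (rule order_trans[OF sum_abs], rule sum_mono)
        fix i assume "i \<in> {..<N}"
        then have "\<bar>branch_real (y i) - branch_real (x i)\<bar> \<le> e / c"
          using l[of "y i" "x i"] y by simp
        then show "\<bar>of_int (M ! j ! i) * (branch_real (y i) - branch_real (x i))\<bar> \<le> \<bar>of_int (M ! j ! i)\<bar> * (e / c)"
          unfolding abs_mult by (intro mult_left_mono) auto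
      qed
      also have "\<dots> = (c - 1) * (e / c)"
        by (simp add: c_def sum_distrib_right sum_divide_distrib)
      also have "\<dots> < e"
        using e(1) c by (simp add: field_simps)
      finally show ?thesis
        using e(2) by (auto simp: dist_real_def abs_minus_commute subset_iff)
    qed
    then show ?thesis
      by blast
  qed
  then obtain l where l: "\<And>j y. j < k \<Longrightarrow> \<forall>i\<in>{..<N}. y i \<inter> {..<l j} = x i \<inter> {..<l j} \<Longrightarrow> lin_comb k N M y j \<in> B j"
    by metis
  have "lin_comb k N M y \<in> U" if y: "\<forall>i\<in>{..<N}. y i \<inter> {..<sum l {..<k}} = x i \<inter> {..<sum l {..<k}}" for y
  proof -
    have "lin_comb k N M y j \<in> B j" if j: "j < k" for j
    proof (rule l[OF j], rule ballI)
      fix i assume i: "i \<in> {..<N}"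
      have "l j \<le> sum l {..<k}"
        using j by (intro member_le_sum) auto
      then have "{..<l j} = {..<sum l {..<k}} \<inter> {..<l j}"
        by auto
      then show "y i \<inter> {..<l j} = x i \<inter> {..<l j}"
        using y i by (metis inf_assoc)
    qed
    then have "lin_comb k N M y \<in> PiE {..<k} B"
      unfolding lin_comb_def by (intro PiE_I) auto
    then show ?thesis
      using B(2) by blast
  qed
  then show "\<exists>l. \<forall>y. (\<forall>i\<in>{..<N}. y i \<inter> {..<l} = x i \<inter> {..<l}) \<longrightarrow> y \<in> {x. lin_comb k N M x \<in> U}"
    unfolding mem_Collect_eq by blast
qed

lemma prefix_open_Ball:
  assumes "finite F" "\<And>M. M \<in> F \<Longrightarrow> prefix_open I {x. P M x}"
  shows "prefix_open I {x. \<forall>M\<in>F. P M x}"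
  unfolding prefix_open_def
proof
  fix x assume x: "x \<in> {x. \<forall>M\<in>F. P M x}"
  have "\<forall>M\<in>F. \<exists>l. \<forall>y. (\<forall>i\<in>I. y i \<inter> {..<l} = x i \<inter> {..<l}) \<longrightarrow> P M y"
  proof
    fix M assume M: "M \<in> F"
    then have "P M x"
      using x by blast
    then show "\<exists>l. \<forall>y. (\<forall>i\<in>I. y i \<inter> {..<l} = x i \<inter> {..<l}) \<longrightarrow> P M y"
      using bspec[OF assms(2)[OF M, unfolded prefix_open_def], of x] by simp
  qed
  from bchoice[OF this] obtain l
    where l: "\<And>M y. M \<in> F \<Longrightarrow> \<forall>i\<in>I. y i \<inter> {..<l M} = x i \<inter> {..<l M} \<Longrightarrow> P M y"
    by blast
  have "P M y" if y: "\<forall>i\<in>I. y i \<inter> {..<sum l F} = x i \<inter> {..<sum l F}" and M: "M \<in> F" for M y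
  proof (rule l[OF M], rule ballI)
    fix i assume i: "i \<in> I"
    have "l M \<le> sum l F"
      using M \<open>finite F\<close> by (intro member_le_sum) auto
    then have "{..<l M} = {..<sum l F} \<inter> {..<l M}"
      by auto
    then show "y i \<inter> {..<l M} = x i \<inter> {..<l M}"
      using y i by (metis inf_assoc)
  qed
  then show "\<exists>l. \<forall>y. (\<forall>i\<in>I. y i \<inter> {..<l} = x i \<inter> {..<l}) \<longrightarrow> y \<in> {x. \<forall>M\<in>F. P M x}"
    by blast
qed

text \<open>The finitely many entries of the tuples in \<open>F\<close> involve only finitely many
  generators. Enumerating all of these as one tuple \<open>x\<close> turns each member of
  \<open>F\<close> into the value at \<open>x\<close> of its own matrix.\<close>

lemma int_span_tuples_lin_comb:
  assumes "finite F" and F: "F \<subseteq> {..<k} \<rightarrow>\<^sub>E int_span.span (branch_real ` P)"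
  obtains N Ms x where "\<And>i. i < N \<Longrightarrow> x i \<in> P" "F = (\<lambda>M. lin_comb k N M x) ` set Ms"
proof -
  have "\<exists>t. finite t \<and> t \<subseteq> branch_real ` P \<and> a \<in> int_span.span t" if "a \<in> int_span.span (branch_real ` P)" for a
    using that unfolding int_span.span_explicit by blast
  then obtain t where t: "\<And>a. a \<in> int_span.span (branch_real ` P) \<Longrightarrow>
      finite (t a) \<and> t a \<subseteq> branch_real ` P \<and> a \<in> int_span.span (t a)"
    by metis
  have in_span: "z j \<in> int_span.span (branch_real ` P)" if "z \<in> F" "j < k" for z j
    using that F by blast
  define T where "T = (\<Union>z\<in>F. \<Union>j<k. t (z j))"
  have "finite T"
    unfolding T_def using \<open>finite F\<close> t in_span by blast
  moreover have "T \<subseteq> branch_real ` P"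
    unfolding T_def using t in_span by blast
  ultimately obtain Q where Q: "Q \<subseteq> P" "finite Q" "T = branch_real ` Q"
    by (meson finite_subset_image)
  obtain x where x: "bij_betw x {0..<card Q} Q"
    using ex_bij_betw_nat_finite[OF Q(2)] by blast
  define N where "N = card Q"
  have "bij_betw branch_real Q T"
    unfolding Q(3) using inj_branch_real by (intro inj_on_imp_bij_betw) (auto intro: inj_on_subset)
  then have bij: "bij_betw (branch_real \<circ> x) {..<N} T"
    using x unfolding N_def lessThan_atLeast0 by (rule bij_betw_trans[rotated])
  have repr: "\<exists>M. z = lin_comb k N M x" if z: "z \<in> F" for z
  proof -
    have "\<exists>u. z j = (\<Sum>a\<in>T. of_int (u a) * a)" if "j < k" for j
    proof -
      have "t (z j) \<subseteq> T"
        unfolding T_def using z that by blast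
      then have "z j \<in> int_span.span T"
        using t[OF in_span[OF z that]] int_span.span_mono by blast
      then show ?thesis
        using int_span.span_finite[OF \<open>finite T\<close>] by blast
    qed
    then obtain u where u: "\<And>j. j < k \<Longrightarrow> z j = (\<Sum>a\<in>T. of_int (u j a) * a)"
      by metis
    define M where "M = map (\<lambda>j. map (\<lambda>i. u j (branch_real (x i))) [0..<N]) [0..<k]"
    have "z j = lin_comb k N M x j" for j
    proof (cases "j < k")
      case True
      have "z j = (\<Sum>i<N. of_int (u j (branch_real (x i))) * branch_real (x i))"
        unfolding u[OF True] using sum.reindex_bij_betw[OF bij, of "\<lambda>a. of_int (u j a) * a"] by simp
      then show ?thesis
        using True by (simp add: lin_comb_def M_def)
    next
      case False
      have "z \<in> {..<k} \<rightarrow>\<^sub>E int_span.span (branch_real ` P)"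
        using z F by blast
      from PiE_arb[OF this, of j] have "z j = undefined"
        using False by simp
      then show ?thesis
        using False by (simp add: lin_comb_def)
    qed
    then show ?thesis
      by (intro exI[of _ M]) auto
  qed
  then obtain M where M: "\<And>z. z \<in> F \<Longrightarrow> z = lin_comb k N (M z) x"
    by metis
  obtain zs where zs: "set zs = F"
    using finite_list[OF \<open>finite F\<close>] by blast
  show thesis
  proof
    show "x i \<in> P" if "i < N" for i
      using that x Q(1) unfolding N_def bij_betw_def by auto
    have "(\<lambda>M. lin_comb k N M x) ` set (map M zs) = (\<lambda>z. lin_comb k N (M z) x) ` F"
      using zs by auto
    also have "\<dots> = (\<lambda>z. z) ` F"
      using M by (intro image_cong) auto
    finally show "F = (\<lambda>M. lin_comb k N M x) ` set (map M zs)"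
      by simp
  qed
qed

lemma lin_comb_in_int_span:
  assumes "\<forall>i\<in>{..<N}. x i \<in> P"
  shows "lin_comb k N M x \<in> {..<k} \<rightarrow>\<^sub>E int_span.span (branch_real ` P)"
proof -
  have "(\<Sum>i<N. of_int (M ! j ! i) * branch_real (x i)) \<in> int_span.span (branch_real ` P)" for j
    by (intro int_span.span_sum int_span.span_scale int_span.span_base imageI) (use assms in blast)
  then show ?thesis
    by (simp add: lin_comb_def restrict_PiE_iff)
qed

context b_scale
begin

definition group_points :: "real set"
  where "group_points = int_span.span (branch_real ` points)"

text \<open>Finite sets \<open>F\<close> instead of single tuples make the statement serve both
  selection principles. For fixed \<open>N\<close> and \<open>Ms\<close> it is pulled back along the
  combinations to a power of \<open>points\<close>; the pairs \<open>(N, Ms)\<close> are countably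
  many, so their bounds have a common bound.\<close>

proposition hurewicz_group_points:
  fixes W :: "nat \<Rightarrow> nat \<Rightarrow> (nat \<Rightarrow> real) set"
  assumes W: "\<And>n m. openin (powertop_real {..<k}) (W n m)"
    and cover: "\<And>F n. finite F \<Longrightarrow> F \<subseteq> {..<k} \<rightarrow>\<^sub>E group_points \<Longrightarrow> \<exists>m. F \<subseteq> W n m"
  shows "\<exists>g. \<forall>F. finite F \<and> F \<subseteq> {..<k} \<rightarrow>\<^sub>E group_points \<longrightarrow> (\<forall>\<^sub>\<infinity>n. \<exists>m\<le>g n. F \<subseteq> W n m)"
proof -
  have "\<exists>g. \<forall>x. (\<forall>i\<in>{..<N}. x i \<in> points) \<longrightarrow>
      (\<forall>\<^sub>\<infinity>n. \<exists>m\<le>g n. x \<in> {x. \<forall>M\<in>set Ms. lin_comb k N M x \<in> W n m})" for N Ms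
  proof (rule hurewicz_points)
    show "prefix_open {..<N} {x. \<forall>M\<in>set Ms. lin_comb k N M x \<in> W n m}" for n m
      by (intro prefix_open_Ball prefix_open_lin_comb W) simp
    show "\<exists>m. x \<in> {x. \<forall>M\<in>set Ms. lin_comb k N M x \<in> W n m}" if x: "\<forall>i\<in>{..<N}. x i \<in> points" for x n
    proof -
      have "(\<lambda>M. lin_comb k N M x) ` set Ms \<subseteq> {..<k} \<rightarrow>\<^sub>E group_points"
        unfolding group_points_def using lin_comb_in_int_span[OF x] by blast
      then obtain m where "(\<lambda>M. lin_comb k N M x) ` set Ms \<subseteq> W n m"
        using cover[of "(\<lambda>M. lin_comb k N M x) ` set Ms" n] by auto
      then show ?thesis
        by blast
    qed
  qed simp
  then have "\<forall>p. \<exists>g. \<forall>x. (\<forall>i\<in>{..<fst p}. x i \<in> points) \<longrightarrow>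
      (\<forall>\<^sub>\<infinity>n. \<exists>m\<le>g n. \<forall>M\<in>set (snd p). lin_comb k (fst p) M x \<in> W n m)"
    unfolding mem_Collect_eq by blast
  from choice[OF this] obtain G :: "nat \<times> int list list list \<Rightarrow> nat \<Rightarrow> nat"
    where G: "\<And>N Ms x. \<forall>i\<in>{..<N}. x i \<in> points \<Longrightarrow>
      \<forall>\<^sub>\<infinity>n. \<exists>m\<le>G (N, Ms) n. \<forall>M\<in>set Ms. lin_comb k N M x \<in> W n m"
    unfolding split_paired_All fst_conv snd_conv by blast
  obtain g where g: "\<And>p. G p \<le>\<^sup>* g"
    using dominatableE[OF dominatable_countable, of UNIV G] by auto
  show ?thesis
  proof (intro exI allI impI)
    fix F assume "finite F \<and> F \<subseteq> {..<k} \<rightarrow>\<^sub>E group_points"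
    then have F: "finite F" "F \<subseteq> {..<k} \<rightarrow>\<^sub>E group_points"
      by simp_all
    obtain N Ms x where x: "\<And>i. i < N \<Longrightarrow> x i \<in> points" "F = (\<lambda>M. lin_comb k N M x) ` set Ms"
      by (rule int_span_tuples_lin_comb[OF F(1) F(2)[unfolded group_points_def]]) (rule that)
    have "\<forall>\<^sub>\<infinity>n. \<exists>m\<le>G (N, Ms) n. \<forall>M\<in>set Ms. lin_comb k N M x \<in> W n m"
      using x(1) by (intro G) auto
    moreover have "\<forall>\<^sub>\<infinity>n. G (N, Ms) n \<le> g n"
      using g unfolding le_star_def by blast
    ultimately show "\<forall>\<^sub>\<infinity>n. \<exists>m\<le>g n. F \<subseteq> W n m"
      by (rule eventually_elim2) (use x(2) le_trans in blast)
  qed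
qed

end

section \<open>The generated group is not \<open>\<sigma>\<close>-compact\<close>

text \<open>\<open>f n\<close> is some \<open>g m\<close>, and \<open>m < n\<close> would give
  \<open>f m = g m = f n\<close>.\<close>

lemma strict_mono_range_le:
  fixes f g :: "nat \<Rightarrow> nat"
  assumes "strict_mono f" "strict_mono g" "range f = range g" "\<And>i. i < n \<Longrightarrow> f i = g i"
  shows "g n \<le> f n"
proof -
  obtain m where m: "f n = g m"
    using assms(3) by (metis rangeE rangeI)
  have "n \<le> m"
  proof (rule ccontr)
    assume "\<not> n \<le> m"
    then have "f n = f m" "m < n"
      using assms(4)[of m] m by auto
    then show False
      using strict_monoD[OF assms(1), of m n] by simp
  qed
  then show ?thesis
    using assms(2) m by (simp add: strict_mono_less_eq)
qed

lemma strict_mono_range_inject: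
  fixes f g :: "nat \<Rightarrow> nat"
  assumes "strict_mono f" "strict_mono g" "range f = range g"
  shows "f = g"
proof
  fix n
  show "f n = g n"
  proof (induction n rule: less_induct)
    case (less n)
    show ?case
      using strict_mono_range_le[OF assms, of n] strict_mono_range_le[OF assms(2,1) assms(3)[symmetric], of n] less
      by simp
  qed
qed

text \<open>The Baire space is represented by \<open>nat \<Rightarrow> nat\<close>, and closedness by approximability on initial
  segments. If \<open>E\<close> is unbounded, discard the basic open sets in which \<open>E\<close> is bounded. For some
  point \<open>x\<close> of the rest \<open>E'\<close>, the points of \<open>E'\<close> that are infinitely often above and infinitely
  often below \<open>x\<close> are then comeagre; \<open>y\<close> is such a point.\<close>

lemma closed_linear_bounded:
  fixes E :: "(nat \<Rightarrow> nat) set"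
  assumes closed: "\<And>y. (\<And>n. \<exists>z\<in>E. \<forall>i<n. z i = y i) \<Longrightarrow> y \<in> E"
    and linear: "\<And>f g. f \<in> E \<Longrightarrow> g \<in> E \<Longrightarrow> f \<le>\<^sup>* g \<or> g \<le>\<^sup>* f"
  shows "\<not> star_unbounded E"
proof
  assume unb: "star_unbounded E"
  define cyl where "cyl s = {z \<in> E. map z [0..<length s] = s}" for s
  define bad where "bad = {s. \<not> star_unbounded (cyl s)}"
  define E' where "E' = E - (\<Union>s\<in>bad. cyl s)"
  have cyl_iff: "z \<in> cyl (map y [0..<n]) \<longleftrightarrow> z \<in> E \<and> (\<forall>i<n. z i = y i)" for z y n
    by (auto simp: cyl_def)
  have bad_bounded: "\<not> star_unbounded (\<Union>s\<in>bad. cyl s)"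
    by (rule bounded_UN) (auto simp: bad_def)
  \<comment> \<open>The discarded part is a countable union of bounded sets, so removing it cannot
    make an unbounded \<open>cyl s\<close> bounded.\<close>
  have good: "star_unbounded (cyl s \<inter> E')" if "s \<notin> bad" for s
  proof (rule ccontr)
    assume "\<not> star_unbounded (cyl s \<inter> E')"
    then have "\<not> star_unbounded (\<Union>b\<in>UNIV. if b then cyl s \<inter> E' else (\<Union>s\<in>bad. cyl s))"
      using bad_bounded by (intro bounded_UN) auto
    moreover have "cyl s \<subseteq> (\<Union>b\<in>UNIV. if b then cyl s \<inter> E' else (\<Union>s\<in>bad. cyl s))"
      unfolding E'_def by (auto simp: UNIV_bool cyl_def)
    ultimately show False
      using that star_unbounded_mono unfolding bad_def by blast
  qed
  have not_bad: "map y [0..<n] \<notin> bad" if "y \<in> E'" for y n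
    using that cyl_iff[of y y n] unfolding E'_def by blast
  have above: "\<exists>z\<in>E'. (\<forall>i<n. z i = y i) \<and> (\<exists>i\<ge>n. x i < z i)" if "y \<in> E'" for x y n
  proof -
    have "\<not> (\<forall>z\<in>cyl (map y [0..<n]) \<inter> E'. z \<le>\<^sup>* x)"
      using good[OF not_bad[OF that]] unfolding star_unbounded_def by blast
    then obtain z where "z \<in> cyl (map y [0..<n])" "z \<in> E'" "\<not> z \<le>\<^sup>* x"
      by blast
    then show ?thesis
      unfolding cyl_iff le_star_def MOST_nat_le by (meson not_le)
  qed
  have unb': "star_unbounded E'"
  proof -
    have "cyl [] = E"
      by (simp add: cyl_def)
    then show ?thesis
      using good[of "[]"] unb star_unbounded_mono[of "cyl [] \<inter> E'" E'] by (auto simp: bad_def)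
  qed
  \<comment> \<open>Otherwise every \<open>x\<close> in \<open>E'\<close> is eventually below all
    points of \<open>E'\<close> in some basic open set, in particular below the one picked there.
    The basic open sets are countably many, so one \<open>g\<close> would bound
    \<open>E'\<close>.\<close>
  have "\<exists>x\<in>E'. \<forall>y\<in>E'. \<forall>n. \<exists>z\<in>E'. (\<forall>i<n. z i = y i) \<and> (\<exists>i\<ge>n. z i < x i)"
  proof (rule ccontr)
    assume neg: "\<not> ?thesis"
    define pick where "pick s = (SOME z. z \<in> E' \<inter> cyl s)" for s
    obtain g where g: "\<And>s. pick s \<le>\<^sup>* g"
      using dominatableE[OF dominatable_countable, of UNIV pick] by auto
    have "x \<le>\<^sup>* g" if "x \<in> E'" for x
    proof -
      obtain y n where y: "y \<in> E'" "\<not> (\<exists>z\<in>E'. (\<forall>i<n. z i = y i) \<and> (\<exists>i\<ge>n. z i < x i))"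
        using neg \<open>x \<in> E'\<close> by blast
      define z where "z = pick (map y [0..<n])"
      have "y \<in> E' \<inter> cyl (map y [0..<n])"
        using y(1) cyl_iff[of y y n] by (simp add: E'_def)
      then have "z \<in> E' \<inter> cyl (map y [0..<n])"
        unfolding z_def pick_def by (rule someI[of "\<lambda>z. z \<in> E' \<inter> cyl (map y [0..<n])"])
      then have "z \<in> E'" "\<forall>i<n. z i = y i"
        using cyl_iff[of z y n] by auto
      then have "\<forall>i\<ge>n. x i \<le> z i"
        using y(2) by (meson leI)
      then have "x \<le>\<^sup>* z"
        unfolding le_star_def MOST_nat_le by blast
      then show ?thesis
        using g[of "map y [0..<n]"] le_star_trans unfolding z_def by blast
    qed
    then show False
      using unb' unfolding star_unbounded_def by blast
  qed
  then obtain x where x: "x \<in> E'"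
    and below: "\<And>y n. y \<in> E' \<Longrightarrow> \<exists>z\<in>E'. (\<forall>i<n. z i = y i) \<and> (\<exists>i\<ge>n. z i < x i)"
    by blast
  define P where "P k p \<longleftrightarrow> fst p \<in> E' \<and> k \<le> snd p" for k :: nat and p :: "(nat \<Rightarrow> nat) \<times> nat"
  \<comment> \<open>The second component of a pair is the length of the part already fixed. Each
    step keeps that part and adds a place above \<open>x\<close> and a place below
    \<open>x\<close>.\<close>
  define R where "R p q \<longleftrightarrow> (\<forall>i<snd p. fst q i = fst p i) \<and> snd p \<le> snd q \<and>
      (\<exists>i\<ge>snd p. i < snd q \<and> x i < fst q i) \<and> (\<exists>i\<ge>snd p. i < snd q \<and> fst q i < x i)"
    for p q :: "(nat \<Rightarrow> nat) \<times> nat"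
  have "\<exists>p. \<forall>k. P k (p k) \<and> R (p k) (p (Suc k))"
  proof (rule dependent_nat_choice)
    show "\<exists>p. P 0 p"
      unfolding P_def using x by auto
    fix p k assume p: "P k p"
    obtain z i where z: "z \<in> E'" "\<forall>j<snd p. z j = fst p j" "i \<ge> snd p" "x i < z i"
      using above[of "fst p" "snd p" x] p unfolding P_def by blast
    obtain w j where w: "w \<in> E'" "\<forall>l<Suc i. w l = z l" "j \<ge> Suc i" "w j < x j"
      using below[OF z(1), of "Suc i"] by blast
    have "P (Suc k) (w, Suc j)"
      using p w(1,3) z(3) unfolding P_def by simp
    moreover have "R p (w, Suc j)"
      unfolding R_def fst_conv snd_conv
    proof (intro conjI)
      show "\<forall>l<snd p. w l = fst p l"
        using w(2) z(2,3) by simp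
      show "\<exists>l\<ge>snd p. l < Suc j \<and> x l < w l"
        using w(2,3) z(3,4) by (intro exI[of _ i]) simp
      show "\<exists>l\<ge>snd p. l < Suc j \<and> w l < x l"
        using w(3,4) z(3) by (intro exI[of _ j]) simp
    qed (use w(3) z(3) in simp)
    ultimately show "\<exists>q. P (Suc k) q \<and> R p q"
      by blast
  qed
  then obtain p where p: "\<And>k. P k (p k)" "\<And>k. R (p k) (p (Suc k))"
    by blast
  define Y where "Y k = fst (p k)" for k
  define N where "N k = snd (p k)" for k
  have Y: "Y k \<in> E'" "k \<le> N k" for k
    using p(1)[of k] by (simp_all add: P_def Y_def N_def)
  have succ: "\<forall>i<N k. Y (Suc k) i = Y k i" "N k \<le> N (Suc k)"
    "\<exists>i\<ge>N k. i < N (Suc k) \<and> x i < Y (Suc k) i" "\<exists>i\<ge>N k. i < N (Suc k) \<and> Y (Suc k) i < x i" for k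
    using p(2)[of k] by (simp_all add: R_def Y_def N_def)
  have N_mono: "N k \<le> N l" if "k \<le> l" for k l
    using that by (rule lift_Suc_mono_le[of N, OF succ(2)])
  have Y_eq: "Y l i = Y k i" if "k \<le> l" "i < N k" for k l i
    using that
  proof (induction l rule: dec_induct)
    case (step l)
    then have "i < N l"
      using N_mono[of k l] by simp
    then show ?case
      using succ(1)[of l] step by simp
  qed simp
  \<comment> \<open>The value at \<open>i\<close> is settled from stage \<open>Suc i\<close> on,
    since \<open>i < Suc i \<le> N (Suc i)\<close>.\<close>
  define y where "y i = Y (Suc i) i" for i
  have y: "y i = Y k i" if "i < N k" for i k
    using Y_eq[of k "Suc i" i] Y_eq[of "Suc i" k i] that Y(2)[of "Suc i"] unfolding y_def by linarith
  have "y \<in> E"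
  proof (rule closed)
    fix n
    have "\<forall>i<n. Y n i = y i"
      using y[of _ n] Y(2)[of n] by simp
    then show "\<exists>z\<in>E. \<forall>i<n. z i = y i"
      using Y(1)[of n] unfolding E'_def by blast
  qed
  moreover have "x \<in> E"
    using x unfolding E'_def by blast
  moreover have "\<not> y \<le>\<^sup>* x"
  proof -
    have "\<exists>i\<ge>n. x i < y i" for n
    proof -
      obtain i where "i \<ge> N n" "i < N (Suc n)" "x i < Y (Suc n) i"
        using succ(3)[of n] by blast
      then show ?thesis
        using y[of i "Suc n"] Y(2)[of n] by (intro exI[of _ i]) simp
    qed
    then show ?thesis
      unfolding le_star_def MOST_nat_le by (meson not_le)
  qed
  moreover have "\<not> x \<le>\<^sup>* y"
  proof -
    have "\<exists>i\<ge>n. y i < x i" for n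
    proof -
      obtain i where "i \<ge> N n" "i < N (Suc n)" "Y (Suc n) i < x i"
        using succ(4)[of n] by blast
      then show ?thesis
        using y[of i "Suc n"] Y(2)[of n] by (intro exI[of _ i]) simp
    qed
    then show ?thesis
      unfolding le_star_def MOST_nat_le by (meson not_le)
  qed
  ultimately show False
    using linear by blast
qed

section \<open>Compact subsets of the group\<close>

text \<open>Strictness compares consecutive values, which a long enough approximation shares. Since
  \<open>i \<le> z i\<close> for increasing \<open>z\<close>, agreement at all arguments below
  \<open>l\<close> gives ranges that agree below \<open>l\<close>, so
  \<open>branch_real (range y)\<close> is a limit of points of \<open>K\<close>.\<close>

lemma closed_branch_real_preimage:
  fixes y :: "nat \<Rightarrow> nat"
  assumes "closed K"
    and approx: "\<And>n. \<exists>z. strict_mono z \<and> branch_real (range z) \<in> K \<and> (\<forall>i<n. z i = y i)"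
  shows "strict_mono y \<and> branch_real (range y) \<in> K"
proof
  show y: "strict_mono y"
    unfolding strict_mono_Suc_iff
  proof
    fix n
    obtain z where "strict_mono z" "\<forall>i<Suc (Suc n). z i = y i"
      using approx by blast
    then show "y n < y (Suc n)"
      using strict_monoD[of z n "Suc n"] by simp
  qed
  have "\<exists>a\<in>K. dist a (branch_real (range y)) < e" if e: "e > 0" for e
  proof -
    obtain l where l: "\<And>A B. A \<inter> {..<l} = B \<inter> {..<l} \<Longrightarrow> \<bar>branch_real A - branch_real B\<bar> < e"
      using branch_real_uniformly_continuous[OF e] by blast
    obtain z where z: "strict_mono z" "branch_real (range z) \<in> K" "\<forall>i<l. z i = y i"
      using approx by blast
    have "range z \<inter> {..<l} = range y \<inter> {..<l}"
    proof -
      have eq: "z i = y i" if "z i < l \<or> y i < l" for i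
        using that z(3) strict_mono_imp_increasing[OF z(1), of i] strict_mono_imp_increasing[OF y, of i] by auto
      have "range z \<inter> {..<l} \<subseteq> range y"
      proof
        fix e assume "e \<in> range z \<inter> {..<l}"
        then obtain i where "e = z i" "z i < l" by blast
        then show "e \<in> range y"
          using eq[of i] by simp
      qed
      moreover have "range y \<inter> {..<l} \<subseteq> range z"
      proof
        fix e assume "e \<in> range y \<inter> {..<l}"
        then obtain i where "e = y i" "y i < l" by blast
        then show "e \<in> range z"
          using eq[of i] by (metis rangeI)
      qed
      ultimately show ?thesis
        by blast
    qed
    then show ?thesis
      using l[of "range z" "range y"] z(2) unfolding dist_real_def by blast
  qed
  then show "branch_real (range y) \<in> K"
    using closed_approachable[OF assms(1)] by blast
qed

context b_scale
begin

lemma range_in_points: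
  assumes "strict_mono f" "range f \<in> points"
  shows "f \<in> S"
proof -
  have "infinite (range f)"
    using assms(1) by (intro range_inj_infinite strict_mono_imp_inj_on)
  then obtain g where "g \<in> S" "range f = range g"
    using assms(2) by (auto simp: points_def)
  then show ?thesis
    using strict_mono_range_inject[OF assms(1) strict_mono] by metis
qed

text \<open>By independence all these functions belong to \<open>S\<close>, hence are comparable,
  and their set is closed because \<open>K\<close> is.\<close>

lemma compact_subset_group_points_bounded:
  assumes "compact K" "K \<subseteq> group_points"
  shows "\<not> star_unbounded {f :: nat \<Rightarrow> nat. strict_mono f \<and> branch_real (range f) \<in> K}"
proof (rule closed_linear_bounded)
  fix y assume "\<And>n. \<exists>z\<in>{f :: nat \<Rightarrow> nat. strict_mono f \<and> branch_real (range f) \<in> K}. \<forall>i<n. z i = y i"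
  then have "\<exists>z. strict_mono z \<and> branch_real (range z) \<in> K \<and> (\<forall>i<n. z i = y i)" for n
    by blast
  then show "y \<in> {f :: nat \<Rightarrow> nat. strict_mono f \<and> branch_real (range f) \<in> K}"
    using closed_branch_real_preimage[OF compact_imp_closed[OF assms(1)], of y] by blast
next
  have "{f :: nat \<Rightarrow> nat. strict_mono f \<and> branch_real (range f) \<in> K} \<subseteq> S"
    using assms(2) range_in_points branch_real_in_int_span unfolding group_points_def by blast
  then show "f \<le>\<^sup>* g \<or> g \<le>\<^sup>* f" if "f \<in> {f :: nat \<Rightarrow> nat. strict_mono f \<and> branch_real (range f) \<in> K}"
    "g \<in> {f :: nat \<Rightarrow> nat. strict_mono f \<and> branch_real (range f) \<in> K}" for f g
    using that linear by blast
qed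

lemma branch_real_in_group_points: "x \<in> points \<Longrightarrow> branch_real x \<in> group_points"
  unfolding group_points_def by (intro int_span.span_base imageI)

proposition not_sigma_compact_group_points: "\<not> sigma_compact_space (top_of_set group_points)"
proof
  assume "sigma_compact_space (top_of_set group_points)"
  then obtain \<K> where \<K>: "countable \<K>" "\<And>K. K \<in> \<K> \<Longrightarrow> compact K \<and> K \<subseteq> group_points" "\<Union>\<K> = group_points"
    unfolding sigma_compact_space_def compactin_subtopology compactin_euclidean_iff by auto
  have "\<not> star_unbounded (\<Union>K\<in>\<K>. {f :: nat \<Rightarrow> nat. strict_mono f \<and> branch_real (range f) \<in> K})"
    using \<K> compact_subset_group_points_bounded by (intro bounded_UN) auto
  moreover have "S \<subseteq> (\<Union>K\<in>\<K>. {f :: nat \<Rightarrow> nat. strict_mono f \<and> branch_real (range f) \<in> K})"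
  proof
    fix f assume "f \<in> S"
    then have "branch_real (range f) \<in> \<Union>\<K>"
      unfolding \<K>(3) by (intro branch_real_in_group_points) (simp add: points_def)
    then show "f \<in> (\<Union>K\<in>\<K>. {f :: nat \<Rightarrow> nat. strict_mono f \<and> branch_real (range f) \<in> K})"
      using strict_mono[OF \<open>f \<in> S\<close>] by blast
  qed
  ultimately show False
    using unbounded star_unbounded_mono by blast
qed

end

section \<open>The cardinality of the generated group\<close>

lemma countable_card_of_ordLeq:
  assumes "countable A" "infinite B"
  shows "|A| \<le>o |B|"
proof -
  obtain f :: "'a \<Rightarrow> nat" where "inj_on f A"
    using assms(1) by (rule countableE)
  then have "|A| \<le>o |UNIV :: nat set|"
    by (rule card_of_ordLeqI) simp
  then show ?thesis
    using assms(2) infinite_iff_card_of_nat ordLeq_transitive by blast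
qed

lemma card_of_int_span:
  assumes "infinite B" "|X| \<le>o |B|"
  shows "|int_span.span X| \<le>o |B|"
proof -
  \<comment> \<open>Sums of \<open>n\<close> integer multiples of elements of \<open>X\<close>;
    every member of the span occurs at some stage.\<close>
  define D where "D n = ((\<lambda>D. (\<lambda>((c, x), y). of_int c * x + y) ` ((UNIV \<times> X) \<times> D)) ^^ n) {0}" for n
  have D: "|D n| \<le>o |B|" for n
  proof (induction n)
    case (Suc n)
    have "|((UNIV :: int set) \<times> X) \<times> D n| \<le>o |B|"
      using assms Suc by (intro card_of_Times_ordLeq_infinite_Field) (auto simp: Field_card_of card_of_card_order_on intro!: countable_card_of_ordLeq)
    then have "|(\<lambda>((c, x), y). of_int c * x + y) ` (((UNIV :: int set) \<times> X) \<times> D n)| \<le>o |B|"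
      using card_of_image ordLeq_transitive by blast
    then show ?case
      by (simp add: D_def)
  qed (simp add: D_def countable_card_of_ordLeq assms(1))
  have "int_span.span X \<subseteq> (\<Union>n. D n)"
  proof
    fix a assume "a \<in> int_span.span X"
    then show "a \<in> (\<Union>n. D n)"
    proof (induction rule: int_span.span_induct_alt)
      case base
      have "0 \<in> D 0"
        by (simp add: D_def)
      then show ?case
        by blast
    next
      case (step c x y)
      then obtain n where "y \<in> D n"
        by blast
      then have "of_int c * x + y \<in> D (Suc n)"
        unfolding D_def using step(1) by force
      then show ?case
        by blast
    qed
  qed
  then have "|int_span.span X| \<le>o |\<Union>n. D n|"
    by (rule card_of_mono1)
  also have "|\<Union>n. D n| \<le>o |B|"
    using assms(1) D by (intro card_of_UNION_ordLeq_infinite) (auto intro!: countable_card_of_ordLeq)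
  finally show ?thesis .
qed

lemma (in b_scale) card_group_points: "|group_points| =o \<bb>"
proof -
  have inf: "infinite S"
    by (rule star_unbounded_infinite[OF unbounded])
  have "|range ` S| \<le>o |S|"
    by (rule card_of_image)
  moreover have "|Collect finite :: nat set set| \<le>o |S|"
    by (intro countable_card_of_ordLeq countable_Collect_finite inf)
  ultimately have "|points| \<le>o |S|"
    unfolding points_def using inf
    by (intro card_of_Un_ordLeq_infinite_Field) (auto simp: Field_card_of card_of_card_order_on)
  then have "|branch_real ` points| \<le>o |S|"
    using card_of_image ordLeq_transitive by blast
  then have "|group_points| \<le>o |S|"
    unfolding group_points_def by (rule card_of_int_span[OF inf])
  moreover have "|S| \<le>o |group_points|"
  proof (rule card_of_ordLeqI)
    show "inj_on (\<lambda>f. branch_real (range f)) S"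
    proof (rule inj_onI)
      fix f g assume "f \<in> S" "g \<in> S" "branch_real (range f) = branch_real (range g)"
      then show "f = g"
        using injD[OF inj_branch_real] strict_mono_range_inject[of f g] strict_mono[of f] strict_mono[of g]
        by blast
    qed
    show "branch_real (range f) \<in> group_points" if "f \<in> S" for f
      using that by (intro branch_real_in_group_points) (simp add: points_def)
  qed
  ultimately show ?thesis
    using card ordIso_iff_ordLeq ordIso_transitive by blast
qed

section \<open>Selection principles\<close>

context b_scale
begin

lemma subgroup_group_points: "subgroup group_points real_group"
proof -
  have "inv\<^bsub>real_group\<^esub> x = - x" for x
    unfolding m_inv_def by (rule the_equality) (auto simp: real_group_def)
  then show ?thesis
    unfolding group_points_def
    by unfold_locales
      (auto simp: real_group_def intro: int_span.span_add int_span.span_zero int_span.span_neg)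
qed

text \<open>Extends the members of a cover to open sets of the full power of the reals, where
  \<open>hurewicz_group_points\<close> applies. The group contains 0, so its power and hence the
  cover are nonempty and a sequence can list the cover.\<close>

lemma ex_open_enumeration:
  assumes "countable \<U>" "open_cover (power_space group_points k) \<U>"
  shows "\<exists>Q :: nat \<Rightarrow> (nat \<Rightarrow> real) set. (\<forall>m. openin (powertop_real {..<k}) (Q m)) \<and>
    (\<lambda>m. Q m \<inter> ({..<k} \<rightarrow>\<^sub>E group_points)) ` UNIV = \<U>"
proof -
  have "0 \<in> group_points"
    unfolding group_points_def by (rule int_span.span_zero)
  then have "{..<k} \<rightarrow>\<^sub>E group_points \<noteq> {}"
    by (auto simp: PiE_eq_empty_iff)
  then have "\<U> \<noteq> {}"
    using assms(2) unfolding open_cover_def topspace_power_space by auto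
  then have range: "range (from_nat_into \<U>) = \<U>"
    using assms(1) by (rule range_from_nat_into)
  have "\<forall>m. \<exists>T. openin (powertop_real {..<k}) T \<and> from_nat_into \<U> m = T \<inter> ({..<k} \<rightarrow>\<^sub>E group_points)"
    using assms(2) from_nat_into[OF \<open>\<U> \<noteq> {}\<close>]
    unfolding open_cover_def power_space_def openin_subtopology by blast
  then obtain Q where Q: "\<And>m. openin (powertop_real {..<k}) (Q m)"
    "\<And>m. from_nat_into \<U> m = Q m \<inter> ({..<k} \<rightarrow>\<^sub>E group_points)"
    by metis
  have "(\<lambda>m. Q m \<inter> ({..<k} \<rightarrow>\<^sub>E group_points)) ` UNIV = \<U>"
    unfolding Q(2)[symmetric] by (rule range)
  then show ?thesis
    using Q(1) by (intro exI[of _ Q]) simp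
qed

text \<open>Applied to the unions of the first \<open>m + 1\<close> members,
  \<open>hurewicz_group_points\<close> makes almost all selected unions contain a given
  point.\<close>

proposition U_fin_power_group_points:
  "U_fin (power_space group_points k) (\<O> (power_space group_points k)) (\<Gamma> (power_space group_points k))"
  unfolding U_fin_def
proof (intro allI impI)
  let ?X = "power_space group_points k" and ?T = "{..<k} \<rightarrow>\<^sub>E group_points"
  fix \<U> :: "nat \<Rightarrow> (nat \<Rightarrow> real) set set"
  assume *: "\<forall>n. \<U> n \<in> \<O> ?X \<and> \<not> (\<exists>\<V>. finite \<V> \<and> \<V> \<subseteq> \<U> n \<and> \<Union>\<V> = topspace ?X)"
  have "\<forall>n. \<exists>Q :: nat \<Rightarrow> (nat \<Rightarrow> real) set. (\<forall>m. openin (powertop_real {..<k}) (Q m)) \<and> (\<lambda>m. Q m \<inter> ?T) ` UNIV = \<U> n"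
  proof
    show "\<exists>Q :: nat \<Rightarrow> (nat \<Rightarrow> real) set. (\<forall>m. openin (powertop_real {..<k}) (Q m)) \<and> (\<lambda>m. Q m \<inter> ?T) ` UNIV = \<U> n" for n
      by (rule ex_open_enumeration) (use * in \<open>simp_all add: countable_open_covers_def\<close>)
  qed
  from choice[OF this] obtain Q :: "nat \<Rightarrow> nat \<Rightarrow> (nat \<Rightarrow> real) set"
    where "\<forall>n. (\<forall>m. openin (powertop_real {..<k}) (Q n m)) \<and> (\<lambda>m. Q n m \<inter> ?T) ` UNIV = \<U> n" ..
  then have Q: "openin (powertop_real {..<k}) (Q n m)"
    and range: "(\<lambda>m. Q n m \<inter> ?T) ` UNIV = \<U> n" for n m
    by simp_all
  have open_\<U>: "openin ?X U" if "U \<in> \<U> n" for U n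
    using * that unfolding countable_open_covers_def open_cover_def by blast
  have cover: "\<Union>(\<U> n) = ?T" for n
    using * unfolding countable_open_covers_def open_cover_def topspace_power_space by blast
  have finite_cover: "\<exists>m. F \<subseteq> (\<Union>j\<le>m. Q n j)" if "finite F" "F \<subseteq> ?T" for F n
    using that
  proof (induction F)
    case (insert z F)
    then obtain m where m: "F \<subseteq> (\<Union>j\<le>m. Q n j)"
      by auto
    have "z \<in> (\<Union>m. Q n m \<inter> ?T)"
      using insert.prems range[of n] cover[of n] by simp
    then obtain j where "z \<in> Q n j"
      by blast
    then have "insert z F \<subseteq> (\<Union>j\<le>max m j. Q n j)"
      using m by fastforce
    then show ?case
      by blast
  qed simp
  have "\<exists>g. \<forall>F. finite F \<and> F \<subseteq> ?T \<longrightarrow> (\<forall>\<^sub>\<infinity>n. \<exists>m\<le>g n. F \<subseteq> (\<Union>j\<le>m. Q n j))"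
  proof (rule hurewicz_group_points)
    show "openin (powertop_real {..<k}) (\<Union>j\<le>m. Q n j)" for n m
      using Q by blast
    show "\<exists>m. F \<subseteq> (\<Union>j\<le>m. Q n j)" if "finite F" "F \<subseteq> ?T" for F n
      using that by (rule finite_cover)
  qed
  then obtain g where "\<forall>F. finite F \<and> F \<subseteq> ?T \<longrightarrow> (\<forall>\<^sub>\<infinity>n. \<exists>m\<le>g n. F \<subseteq> (\<Union>j\<le>m. Q n j))" ..
  then have g: "\<forall>\<^sub>\<infinity>n. \<exists>m\<le>g n. F \<subseteq> (\<Union>j\<le>m. Q n j)" if "finite F" "F \<subseteq> ?T" for F
    using that by simp
  define \<F> where "\<F> n = (\<lambda>m. Q n m \<inter> ?T) ` {..g n}" for n
  have \<F>: "finite (\<F> n)" "\<F> n \<subseteq> \<U> n" for n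
    using range[of n] by (auto simp: \<F>_def)
  have gamma: "\<forall>\<^sub>\<infinity>n. z \<in> \<Union>(\<F> n)" if "z \<in> ?T" for z
    using g[of "{z}"] that unfolding \<F>_def by (auto elim!: eventually_mono dest: le_trans)
  have sub: "\<Union>(\<F> n) \<subseteq> ?T" for n
    unfolding \<F>_def by blast
  have proper: "\<Union>(\<F> n) \<noteq> ?T" for n
  proof
    assume "\<Union>(\<F> n) = ?T"
    then have "\<exists>\<V>. finite \<V> \<and> \<V> \<subseteq> \<U> n \<and> \<Union>\<V> = topspace ?X"
      unfolding topspace_power_space using \<F>[of n] by (intro exI[of _ "\<F> n"]) simp
    then show False
      using * by simp
  qed
  let ?R = "range (\<lambda>n. \<Union>(\<F> n))"
  \<comment> \<open>A value taken infinitely often would contain every point, but without finite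
    subcovers no selected union is the whole space.\<close>
  have "infinite ?R"
  proof
    assume "finite ?R"
    then obtain n where inf: "infinite {m. \<Union>(\<F> m) = \<Union>(\<F> n)}"
      using pigeonhole_infinite[of UNIV "\<lambda>n. \<Union>(\<F> n)"] by auto
    have "z \<in> \<Union>(\<F> n)" if "z \<in> ?T" for z
    proof -
      have "finite {m. z \<notin> \<Union>(\<F> m)}"
        using gamma[OF that] unfolding eventually_cofinite .
      then obtain m where "m \<in> {m. \<Union>(\<F> m) = \<Union>(\<F> n)}" "m \<notin> {m. z \<notin> \<Union>(\<F> m)}"
        using inf by (meson finite_subset subsetI)
      then show ?thesis
        by blast
    qed
    then show False
      using sub[of n] proper[of n] by blast
  qed
  moreover have "finite {U \<in> ?R. z \<notin> U}" if "z \<in> ?T" for z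
  proof -
    have "finite ((\<lambda>n. \<Union>(\<F> n)) ` {n. z \<notin> \<Union>(\<F> n)})"
      using gamma[OF that] unfolding eventually_cofinite by (rule finite_imageI)
    moreover have "{U \<in> ?R. z \<notin> U} \<subseteq> (\<lambda>n. \<Union>(\<F> n)) ` {n. z \<notin> \<Union>(\<F> n)}"
    proof
      fix U assume "U \<in> {U \<in> ?R. z \<notin> U}"
      then obtain n where "U = \<Union>(\<F> n)" "z \<notin> U"
        by blast
      then show "U \<in> (\<lambda>n. \<Union>(\<F> n)) ` {n. z \<notin> \<Union>(\<F> n)}"
        by simp
    qed
    ultimately show ?thesis
      by (rule finite_subset[rotated])
  qed
  moreover have "openin ?X U" if U: "U \<in> ?R" for U
  proof -
    obtain n where "U = \<Union>(\<F> n)"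
      using U by blast
    moreover have "openin ?X V" if "V \<in> \<F> n" for V
      using open_\<U>[of V n] \<F>(2)[of n] that by blast
    ultimately show ?thesis
      by (simp add: openin_Union)
  qed
  moreover have "\<Union>?R = ?T"
  proof
    show "?T \<subseteq> \<Union>?R"
    proof
      fix z assume "z \<in> ?T"
      then obtain n where "z \<in> \<Union>(\<F> n)"
        using gamma[of z] unfolding MOST_nat_le by blast
      then show "z \<in> \<Union>?R"
        by blast
    qed
  qed (use sub in blast)
  ultimately have "?R \<in> \<Gamma> ?X"
    unfolding countable_gamma_covers_def gamma_cover_def open_cover_def topspace_power_space
    by simp
  then show "\<exists>\<F>. (\<forall>n. finite (\<F> n) \<and> \<F> n \<subseteq> \<U> n) \<and> range (\<lambda>n. \<Union>(\<F> n)) \<in> \<Gamma> ?X"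
    using \<F> by blast
qed

text \<open>In an \<omega>-cover single members already contain the given finite sets, so the bound
  of \<open>hurewicz_group_points\<close> selects without forming unions.\<close>

proposition S_fin_power_group_points:
  "S_fin (\<Omega> (power_space group_points k)) (\<Omega> (power_space group_points k))"
  unfolding S_fin_def
proof (intro allI impI)
  let ?X = "power_space group_points k" and ?T = "{..<k} \<rightarrow>\<^sub>E group_points"
  fix \<U> :: "nat \<Rightarrow> (nat \<Rightarrow> real) set set"
  assume *: "\<forall>n. \<U> n \<in> \<Omega> ?X"
  have "\<forall>n. \<exists>Q :: nat \<Rightarrow> (nat \<Rightarrow> real) set. (\<forall>m. openin (powertop_real {..<k}) (Q m)) \<and> (\<lambda>m. Q m \<inter> ?T) ` UNIV = \<U> n"
  proof
    show "\<exists>Q :: nat \<Rightarrow> (nat \<Rightarrow> real) set. (\<forall>m. openin (powertop_real {..<k}) (Q m)) \<and> (\<lambda>m. Q m \<inter> ?T) ` UNIV = \<U> n" for n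
      by (rule ex_open_enumeration) (use * in \<open>simp_all add: countable_omega_covers_def omega_cover_def\<close>)
  qed
  from choice[OF this] obtain Q :: "nat \<Rightarrow> nat \<Rightarrow> (nat \<Rightarrow> real) set"
    where "\<forall>n. (\<forall>m. openin (powertop_real {..<k}) (Q n m)) \<and> (\<lambda>m. Q n m \<inter> ?T) ` UNIV = \<U> n" ..
  then have Q: "openin (powertop_real {..<k}) (Q n m)"
    and range: "(\<lambda>m. Q n m \<inter> ?T) ` UNIV = \<U> n" for n m
    by simp_all
  have omega: "omega_cover ?X (\<U> n)" for n
    using * unfolding countable_omega_covers_def by blast
  have "\<exists>g. \<forall>F. finite F \<and> F \<subseteq> ?T \<longrightarrow> (\<forall>\<^sub>\<infinity>n. \<exists>m\<le>g n. F \<subseteq> Q n m)"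
  proof (rule hurewicz_group_points[OF Q])
    show "\<exists>m. F \<subseteq> Q n m" if F: "finite F" "F \<subseteq> ?T" for F n
    proof -
      obtain U where "U \<in> \<U> n" "F \<subseteq> U"
        using omega[of n] F unfolding omega_cover_def topspace_power_space by blast
      then show ?thesis
        unfolding range[of n, symmetric] by blast
    qed
  qed
  then obtain g where "\<forall>F. finite F \<and> F \<subseteq> ?T \<longrightarrow> (\<forall>\<^sub>\<infinity>n. \<exists>m\<le>g n. F \<subseteq> Q n m)" ..
  then have g: "\<forall>\<^sub>\<infinity>n. \<exists>m\<le>g n. F \<subseteq> Q n m" if "finite F" "F \<subseteq> ?T" for F
    using that by simp
  define \<F> where "\<F> n = (\<lambda>m. Q n m \<inter> ?T) ` {..g n}" for n
  have \<F>: "finite (\<F> n)" "\<F> n \<subseteq> \<U> n" for n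
    using range[of n] by (auto simp: \<F>_def)
  have in_\<F>: "\<exists>U\<in>(\<Union>n. \<F> n). F \<subseteq> U" if F: "finite F" "F \<subseteq> ?T" for F
  proof -
    obtain n m where "m \<le> g n" "F \<subseteq> Q n m"
      using g[OF F] unfolding MOST_nat_le by blast
    then have "Q n m \<inter> ?T \<in> \<F> n" "F \<subseteq> Q n m \<inter> ?T"
      using F(2) by (simp_all add: \<F>_def)
    then show ?thesis
      by blast
  qed
  have sub: "U \<subseteq> ?T" if "U \<in> (\<Union>n. \<F> n)" for U
    using that unfolding \<F>_def by blast
  have "\<Union>(\<Union>n. \<F> n) = ?T"
  proof
    show "?T \<subseteq> \<Union>(\<Union>n. \<F> n)"
    proof
      fix z assume "z \<in> ?T"
      then show "z \<in> \<Union>(\<Union>n. \<F> n)"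
        using in_\<F>[of "{z}"] by auto
    qed
  qed (use sub in blast)
  moreover have members: "openin ?X U \<and> U \<noteq> ?T" if "U \<in> (\<Union>n. \<F> n)" for U
  proof -
    obtain n where "U \<in> \<U> n"
      using \<open>U \<in> (\<Union>n. \<F> n)\<close> \<F>(2) by blast
    moreover have "\<forall>U\<in>\<U> n. openin ?X U" "?T \<notin> \<U> n"
      using omega[of n] unfolding omega_cover_def open_cover_def topspace_power_space by simp_all
    ultimately show ?thesis
      by blast
  qed
  moreover have "?T \<notin> (\<Union>n. \<F> n)"
    using members by blast
  moreover have "countable (\<Union>n. \<F> n)"
    using \<F>(1) by (simp add: countable_finite)
  ultimately have "(\<Union>n. \<F> n) \<in> \<Omega> ?X"
    unfolding countable_omega_covers_def omega_cover_def open_cover_def topspace_power_space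
    using in_\<F> by (intro CollectI conjI ballI allI impI notI) simp_all
  then show "\<exists>\<F>. (\<forall>n. finite (\<F> n) \<and> \<F> n \<subseteq> \<U> n) \<and> (\<Union>n. \<F> n) \<in> \<Omega> ?X"
    using \<F> by blast
qed

end

theorem theorem1:
  shows "\<exists>G :: real set.
    subgroup G real_group \<and>
    \<not> sigma_compact_space (top_of_set G) \<and>
    |G| =o \<bb> \<and>
    (\<forall>k\<ge>1. U_fin (power_space G k) (\<O> (power_space G k)) (\<Gamma> (power_space G k))) \<and>
    (\<forall>k\<ge>1. S_fin (\<Omega> (power_space G k)) (\<Omega> (power_space G k)))"
proof -
  obtain S where "b_scale S"
    using ex_b_scale by blast
  then interpret b_scale S .
  show ?thesis
    using subgroup_group_points not_sigma_compact_group_points card_group_points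
      U_fin_power_group_points S_fin_power_group_points by blast
qed

end
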